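(* Let $\mathcal D$ be a finite set with $T=|\mathcal D|\ge 1$, let $\mathcal Q$ be a nonempty finite family of functions with $k=|\mathcal Q|\ge 1$, let $n\ge 1$ be an integer, and suppose every $q\in\mathcal Q$ maps $\mathcal D$ to $[-1,1]$. For every real $\varepsilon>0$ there exists a randomized mechanism $M_2$, with inputs $x\in\mathcal D^n$ and output in $\mathbb R^{\mathcal Q}$, that is pure $\varepsilon$-differentially private and satisfies $$\sup_{x\in\mathcal D^n}\frac1{\sqrt k}\,\mathbb E\,\|M_2(x)-F(x)\|_2\le 62e\,\min\left\{1,\sqrt{\frac{\log(2T)}{\varepsilon n}}\right\}.$$
   Context: For $x=(x_1,\dots,x_n)\in\mathcal D^n$ and $q\in\mathcal Q$, put $F_q(x)=\frac1n\sum_{i=1}^n q(x_i)$ and $F(x)=(F_q(x))_{q\in\mathcal Q}\in\mathbb R^{\mathcal Q}$. Here $\|z\|_2=(\sum_{q\in\mathcal Q}z_q^2)^{1/2}$, $\log$ is the natural logarithm, and $e$ is Euler's number. All probability spaces are finite: a randomized mechanism assigns to each $x\in\mathcal D^n$ a random output whose law has finite support. Two databases $x,x'\in\mathcal D^n$ are neighboring if they differ in exactly one coordinate (Hamming distance one). A mechanism $M$ is pure $\varepsilon$-differentially private if for all neighboring $x,x'$ and every subset $E$ of its output space, $\mathbb P[M(x)\in E]\le e^{\varepsilon}\,\mathbb P[M(x')\in E]$. *)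

theory Defs
  imports "HOL-Probability.Probability"
begin

definition databases :: "nat \<Rightarrow> 'd set \<Rightarrow> (nat \<Rightarrow> 'd) set"
  where "databases n D = {1..n} \<rightarrow>\<^sub>E D"

definition neighboring :: "nat \<Rightarrow> (nat \<Rightarrow> 'd) \<Rightarrow> (nat \<Rightarrow> 'd) \<Rightarrow> bool"
  where "neighboring n x x' \<longleftrightarrow> card {i \<in> {1..n}. x i \<noteq> x' i} = 1"

text \<open>The space of real vectors indexed by \<open>Q\<close>, represented by extensional functions.\<close>

definition real_vectors :: "'q set \<Rightarrow> ('q \<Rightarrow> real) set"
  where "real_vectors Q = Q \<rightarrow>\<^sub>E UNIV"

text \<open>
  The queries form a family indexed by \<open>Q\<close>, so repeated functions are allowed. A set of functions
  is the special case where \<open>query\<close> is the identity.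
\<close>

definition answers :: "nat \<Rightarrow> 'q set \<Rightarrow> ('q \<Rightarrow> 'd \<Rightarrow> real) \<Rightarrow> (nat \<Rightarrow> 'd) \<Rightarrow> 'q \<Rightarrow> real"
  where "answers n Q query x = (\<lambda>q\<in>Q. (1 / real n) * (\<Sum>i=1..n. query q (x i)))"

definition randomized_mechanism ::
    "nat \<Rightarrow> 'd set \<Rightarrow> 'b set \<Rightarrow> ((nat \<Rightarrow> 'd) \<Rightarrow> 'b pmf) \<Rightarrow> bool"
  where "randomized_mechanism n D Y M \<longleftrightarrow>
    (\<forall>x \<in> databases n D. finite (set_pmf (M x)) \<and> set_pmf (M x) \<subseteq> Y)"

definition pure_differentially_private ::
    "nat \<Rightarrow> 'd set \<Rightarrow> 'b set \<Rightarrow> real \<Rightarrow> ((nat \<Rightarrow> 'd) \<Rightarrow> 'b pmf) \<Rightarrow> bool"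
  where "pure_differentially_private n D Y \<epsilon> M \<longleftrightarrow>
    (\<forall>x \<in> databases n D. \<forall>x' \<in> databases n D. neighboring n x x' \<longrightarrow>
      (\<forall>E \<subseteq> Y. measure_pmf.prob (M x) E \<le> exp \<epsilon> * measure_pmf.prob (M x') E))"

end

theory Submission
  imports Defs
begin

text \<open>
  The mechanism adds noise to the vector of query sums and outputs the answers of the database whose
  query sums are nearest to the result. If \<open>w\<close> is the noise, the squared error of this least squares
  step is at most \<open>2 \<langle>w, \<delta>\<rangle>\<close>, where \<open>\<delta>\<close> is a sum of \<open>2 n\<close> vectors \<open>\<plusminus> v\<^sub>d\<close> with
  \<open>v\<^sub>d = (q d)\<^sub>q\<close>, so it is enough to control the maximum of \<open>\<langle>w, \<plusminus> v\<^sub>d\<rangle>\<close>.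

  The noise is Gaussian, of variance about \<open>k log (2 T) / \<epsilon>\<^sup>2\<close> per coordinate, plus a random number
  of jumps along random rays \<open>\<plusminus> v\<^sub>d\<close>, the number and the lengths of the jumps being geometric.
  The Gaussian alone violates pure privacy for a shift by \<open>v\<^sub>d\<close> only where \<open>\<langle>w, v\<^sub>d\<rangle>\<close> is so large
  that the Gaussian density, moved by a jump along \<open>v\<^sub>d\<close>, exceeds the unmoved one by a factor of
  order \<open>T\<close>; this pays for the probability \<open>1 / (4 T)\<close> of making that jump. The mixture \<open>F\<close> solves
  \<open>F = g + A F\<close> for the jump operator \<open>A\<close> of norm \<open>1 / 2\<close>, and the privacy inequality passes from
  \<open>g\<close> to \<open>F\<close> because \<open>A\<close> is positive, commutes with shifts, and halves any constant defect.
\<close>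

section \<open>Mixtures over geometric jumps\<close>

text \<open>If \<open>w\<close> has density \<open>f\<close>, this is the density of
  \<open>w + c u\<close>, where \<open>c\<close> is geometric with weights
  \<open>(1 - \<theta>) \<theta>^c\<close>. Values lie in \<open>ennreal\<close>, so series and
  suprema of densities always exist.\<close>

definition ray_avg :: "real \<Rightarrow> ('q \<Rightarrow> real) \<Rightarrow> (('q \<Rightarrow> real) \<Rightarrow> ennreal) \<Rightarrow> ('q \<Rightarrow> real) \<Rightarrow> ennreal"
  where "ray_avg \<theta> u f w = (\<Sum>c. ennreal ((1 - \<theta>) * \<theta> ^ c) * f (\<lambda>q. w q - real c * u q))"

lemma suminf_geometric_weights:
  assumes "0 < \<theta>" "\<theta> < 1"
  shows "(\<Sum>c. ennreal ((1 - \<theta>) * \<theta> ^ c)) = 1"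
proof -
  have "(\<lambda>c. (1 - \<theta>) * \<theta> ^ c) sums ((1 - \<theta>) * (1 / (1 - \<theta>)))"
    using assms by (intro sums_mult geometric_sums) auto
  then show ?thesis
    using assms by (subst suminf_ennreal_eq[where x = 1]) auto
qed

lemma suminf_geometric_mean:
  assumes "0 < \<theta>" "\<theta> < 1"
  shows "(\<Sum>c. ennreal ((1 - \<theta>) * \<theta> ^ c) * ennreal (real c)) = ennreal (\<theta> / (1 - \<theta>))"
proof -
  have "(\<lambda>n. diffs (\<lambda>n. 1) n * \<theta> ^ n) sums (1 / (1 - \<theta>)^2)"
    using geometric_deriv_sums[of \<theta>] assms by (simp add: diffs_def)
  then have "(\<lambda>c. real (Suc c) * \<theta> ^ c) sums (1 / (1 - \<theta>)^2)"
    by (simp add: diffs_def)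
  then have "(\<lambda>c. (1 - \<theta>) * \<theta> * (real (Suc c) * \<theta> ^ c)) sums ((1 - \<theta>) * \<theta> * (1 / (1 - \<theta>)^2))"
    by (rule sums_mult)
  also have "(1 - \<theta>) * \<theta> * (1 / (1 - \<theta>)^2) = \<theta> / (1 - \<theta>)"
    using assms by (simp add: power2_eq_square)
  also have "(\<lambda>c. (1 - \<theta>) * \<theta> * (real (Suc c) * \<theta> ^ c)) = (\<lambda>c. (1 - \<theta>) * \<theta> ^ Suc c * real (Suc c))"
    by (simp add: algebra_simps)
  finally have "(\<lambda>c. (1 - \<theta>) * \<theta> ^ Suc c * real (Suc c)) sums (\<theta> / (1 - \<theta>))" .
  then have "(\<lambda>c. (1 - \<theta>) * \<theta> ^ c * real c) sums (\<theta> / (1 - \<theta>))"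
    by (subst (asm) sums_Suc_iff) simp
  then show ?thesis
    using assms by (subst suminf_ennreal_eq[symmetric, where x = "\<theta> / (1 - \<theta>)"]) (auto simp: ennreal_mult)
qed

lemma ray_avg_mono:
  assumes "\<And>w. f w \<le> g w"
  shows "ray_avg \<theta> u f w \<le> ray_avg \<theta> u g w"
  unfolding ray_avg_def by (intro suminf_le mult_left_mono assms) auto

lemma ray_avg_add_const:
  assumes "0 < \<theta>" "\<theta> < 1"
  shows "ray_avg \<theta> u (\<lambda>w. f w + b) w = ray_avg \<theta> u f w + b"
proof -
  have "ray_avg \<theta> u (\<lambda>w. f w + b) w = ray_avg \<theta> u f w + (\<Sum>c. ennreal ((1 - \<theta>) * \<theta> ^ c) * b)"
    unfolding ray_avg_def by (subst suminf_add) (simp_all add: distrib_left)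
  then show ?thesis
    by (simp add: suminf_geometric_weights[OF assms])
qed

lemma ray_avg_cmult:
  "ray_avg \<theta> u (\<lambda>w. b * f w) w = b * ray_avg \<theta> u f w"
  unfolding ray_avg_def by (subst ennreal_suminf_cmult[symmetric]) (simp add: mult_ac)

lemma ray_avg_translate:
  "ray_avg \<theta> u (\<lambda>w. f (\<lambda>q. w q - v q)) w = ray_avg \<theta> u f (\<lambda>q. w q - v q)"
  unfolding ray_avg_def by (simp add: algebra_simps)

text \<open>The operator identity \<open>G = (1 - \<theta>) + \<theta> S G\<close> for \<open>G = (1 - \<theta>) (1 - \<theta> S)\<^sup>-\<^sup>1\<close>.\<close>

lemma ray_avg_unfold:
  assumes "0 < \<theta>" "\<theta> < 1"
  shows "ray_avg \<theta> u f w = ennreal (1 - \<theta>) * f w + ennreal \<theta> * ray_avg \<theta> u f (\<lambda>q. w q - u q)"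
proof -
  have "ennreal \<theta> * ray_avg \<theta> u f (\<lambda>q. w q - u q)
      = (\<Sum>c. ennreal ((1 - \<theta>) * \<theta> ^ Suc c) * f (\<lambda>q. w q - real (Suc c) * u q))"
    unfolding ray_avg_def
    using assms by (subst ennreal_suminf_cmult[symmetric])
      (simp add: algebra_simps ennreal_mult[symmetric] flip: mult.assoc)
  then show ?thesis
    unfolding ray_avg_def
    by (subst suminf_offset[where i = 1]) (simp_all add: add.commute)
qed

section \<open>The fixed point of the jump operator and its behaviour under shifts\<close>

primrec jump_iter :: "real \<Rightarrow> 'e set \<Rightarrow> ('e \<Rightarrow> 'q \<Rightarrow> real) \<Rightarrow> (('q \<Rightarrow> real) \<Rightarrow> ennreal) \<Rightarrow> nat
    \<Rightarrow> ('q \<Rightarrow> real) \<Rightarrow> ennreal"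
  where
    "jump_iter \<theta> E u g 0 = g"
  | "jump_iter \<theta> E u g (Suc j) =
      (\<lambda>w. g w + ennreal (1 / (2 * card E)) * (\<Sum>e\<in>E. ray_avg \<theta> (u e) (jump_iter \<theta> E u g j) w))"

text \<open>The iterates are the partial sums of the Neumann series of terms \<open>A^i g\<close>,
  where \<open>A\<close> is half the mean of the operators \<open>ray_avg \<theta> (u e)\<close>;
  they increase, so the supremum is their limit. For \<open>g\<close> of mass 1/2 this is the
  density after a number of jumps that is geometric with ratio 1/2.\<close>

definition jump_density :: "real \<Rightarrow> 'e set \<Rightarrow> ('e \<Rightarrow> 'q \<Rightarrow> real) \<Rightarrow> (('q \<Rightarrow> real) \<Rightarrow> ennreal)
    \<Rightarrow> ('q \<Rightarrow> real) \<Rightarrow> ennreal"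
  where "jump_density \<theta> E u g w = (SUP j. jump_iter \<theta> E u g j w)"

lemma jump_iter_ge: "g w \<le> jump_iter \<theta> E u g j w"
  by (cases j) auto

lemma jump_iter_mono_Suc: "jump_iter \<theta> E u g j w \<le> jump_iter \<theta> E u g (Suc j) w"
proof (induction j arbitrary: w)
  case (Suc j)
  show ?case
    unfolding jump_iter.simps(2)[of _ _ _ _ "Suc j"]
    by (subst jump_iter.simps(2)) (intro add_left_mono mult_left_mono sum_mono ray_avg_mono Suc, simp)
qed simp

lemma incseq_jump_iter: "incseq (\<lambda>j. jump_iter \<theta> E u g j w)"
  by (intro incseq_SucI jump_iter_mono_Suc)

text \<open>Induction along \<open>F_(j+1) = g + A F_j\<close>. By \<open>source\<close>, the loss
  of \<open>g\<close> under the shift is charged to a fraction \<open>1 - \<theta>\<close> of the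
  jump term in direction \<open>e\<close>, and that term can spare it. The other directions only
  inherit the induction hypothesis, whose additive defect is halved by \<open>A\<close>.\<close>

lemma jump_iter_translate_le:
  assumes "finite E" "e \<in> E" "0 < \<theta>" "\<theta> < 1"
    and source: "\<And>w. ennreal (\<theta>^2) * g (\<lambda>q. w q - u e q)
      \<le> g w + ennreal (1 / (2 * card E)) * (ennreal (1 - \<theta>) * ray_avg \<theta> (u e) g w)"
    and bdd: "\<And>w. g w \<le> ennreal B" and "0 \<le> B"
  shows "ennreal (\<theta>^2) * jump_iter \<theta> E u g j (\<lambda>q. w q - u e q) \<le> jump_iter \<theta> E u g j w + ennreal (B / 2 ^ j)"
proof (induction j arbitrary: w)
  case 0
  have "ennreal (\<theta>^2) * g (\<lambda>q. w q - u e q) \<le> 1 * g (\<lambda>q. w q - u e q)"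
    using assms(3,4) by (intro mult_right_mono) (auto simp: power_le_one)
  also have "\<dots> \<le> ennreal B" using bdd by simp
  also have "\<dots> \<le> g w + ennreal B" by simp
  finally show ?case by simp
next
  case (Suc j)
  define F where "F = jump_iter \<theta> E u g j"
  define \<rho> where "\<rho> = ennreal (1 / (2 * card E))"
  define b where "b = ennreal (B / 2 ^ j)"
  define w' where "w' = (\<lambda>q. w q - u e q)"
  let ?t = "ennreal (\<theta>^2)"
  have IH: "?t * F (\<lambda>q. w q - u e q) \<le> F w + b" for w
    unfolding F_def b_def by (rule Suc)
  have other: "?t * ray_avg \<theta> (u d) F w' \<le> ray_avg \<theta> (u d) F w + b" for d
  proof -
    have "?t * ray_avg \<theta> (u d) F w' = ray_avg \<theta> (u d) (\<lambda>w. ?t * F (\<lambda>q. w q - u e q)) w"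
      unfolding w'_def by (simp add: ray_avg_cmult ray_avg_translate)
    also have "\<dots> \<le> ray_avg \<theta> (u d) (\<lambda>w. F w + b) w"
      by (intro ray_avg_mono IH)
    finally show ?thesis using assms by (simp add: ray_avg_add_const)
  qed
  have self: "?t * ray_avg \<theta> (u e) F w' + ennreal (1 - \<theta>) * ray_avg \<theta> (u e) g w \<le> ray_avg \<theta> (u e) F w + b"
  proof -
    have "ennreal \<theta> * ray_avg \<theta> (u e) F w' \<le> ray_avg \<theta> (u e) F w"
      using ray_avg_unfold[OF assms(3,4), of "u e" F w] by (simp add: w'_def)
    then have "ennreal \<theta> * (ennreal \<theta> * ray_avg \<theta> (u e) F w') \<le> ennreal \<theta> * ray_avg \<theta> (u e) F w"
      by (intro mult_left_mono) auto
    then have 1: "?t * ray_avg \<theta> (u e) F w' \<le> ennreal \<theta> * ray_avg \<theta> (u e) F w"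
      using assms by (simp add: power2_eq_square ennreal_mult mult.assoc)
    have 2: "ennreal (1 - \<theta>) * ray_avg \<theta> (u e) g w \<le> ennreal (1 - \<theta>) * ray_avg \<theta> (u e) F w"
      unfolding F_def by (intro mult_left_mono ray_avg_mono jump_iter_ge) auto
    have "?t * ray_avg \<theta> (u e) F w' + ennreal (1 - \<theta>) * ray_avg \<theta> (u e) g w
        \<le> (ennreal \<theta> + ennreal (1 - \<theta>)) * ray_avg \<theta> (u e) F w"
      using add_mono[OF 1 2] by (simp add: distrib_right)
    also have "ennreal \<theta> + ennreal (1 - \<theta>) = 1"
      using assms by (subst ennreal_plus[symmetric]) auto
    finally show ?thesis by (simp add: add_increasing2)
  qed
  have cE: "card E > 0" using assms card_gt_0_iff by blast
  have "?t * jump_iter \<theta> E u g (Suc j) w'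
     = ?t * g w' + \<rho> * (\<Sum>d\<in>E. ?t * ray_avg \<theta> (u d) F w')"
    by (simp add: F_def \<rho>_def distrib_left sum_distrib_left mult_ac)
  also have "\<dots> \<le> g w + \<rho> * (ennreal (1 - \<theta>) * ray_avg \<theta> (u e) g w) + \<rho> * (\<Sum>d\<in>E. ?t * ray_avg \<theta> (u d) F w')"
    unfolding w'_def \<rho>_def by (intro add_right_mono source)
  also have "\<dots> = g w + \<rho> * ((?t * ray_avg \<theta> (u e) F w' + ennreal (1 - \<theta>) * ray_avg \<theta> (u e) g w)
      + (\<Sum>d\<in>E - {e}. ?t * ray_avg \<theta> (u d) F w'))"
    using assms by (simp add: sum.remove[of E e] distrib_left add_ac)
  also have "\<dots> \<le> g w + \<rho> * ((ray_avg \<theta> (u e) F w + b) + (\<Sum>d\<in>E - {e}. ray_avg \<theta> (u d) F w + b))"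
    by (intro add_left_mono mult_left_mono add_mono self sum_mono other) auto
  also have "(ray_avg \<theta> (u e) F w + b) + (\<Sum>d\<in>E - {e}. ray_avg \<theta> (u d) F w + b) = (\<Sum>d\<in>E. ray_avg \<theta> (u d) F w + b)"
    using assms by (simp add: sum.remove[of E e])
  also have "\<dots> = (\<Sum>d\<in>E. ray_avg \<theta> (u d) F w) + of_nat (card E) * b"
    by (simp add: sum.distrib)
  also have "g w + \<rho> * \<dots> = jump_iter \<theta> E u g (Suc j) w + \<rho> * (of_nat (card E) * b)"
    by (simp add: F_def \<rho>_def distrib_left add_ac)
  \<comment> \<open>There are \<open>card E\<close> equal defects \<open>b\<close>, each weighted by
    \<open>1 / (2 * card E)\<close>, so \<open>b / 2\<close> remains.\<close>
  also have "\<rho> * (of_nat (card E) * b) = ennreal (B / 2 ^ Suc j)"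
    using cE assms \<open>e \<in> E\<close> by (auto simp: \<rho>_def b_def ennreal_of_nat_eq_real_of_nat field_simps simp flip: ennreal_mult)
  finally show ?case by (simp add: w'_def)
qed

lemma jump_density_translate_le:
  assumes "finite E" "e \<in> E" "0 < \<theta>" "\<theta> < 1"
    and source: "\<And>w. ennreal (\<theta>^2) * g (\<lambda>q. w q - u e q)
      \<le> g w + ennreal (1 / (2 * card E)) * (ennreal (1 - \<theta>) * ray_avg \<theta> (u e) g w)"
    and bdd: "\<And>w. g w \<le> ennreal B" and "0 \<le> B"
  shows "ennreal (\<theta>^2) * jump_density \<theta> E u g (\<lambda>q. w q - u e q) \<le> jump_density \<theta> E u g w"
proof -
  let ?F = "jump_density \<theta> E u g w"
  \<comment> \<open>The iterate \<open>i\<close> on the left stays fixed while the level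
    \<open>j\<close> of the estimate tends to infinity; monotonicity in the level allows this and
    the defect vanishes.\<close>
  have "ennreal (\<theta>^2) * jump_iter \<theta> E u g i (\<lambda>q. w q - u e q) \<le> ?F" for i
  proof (rule LIMSEQ_le_const)
    have "(\<lambda>j. B / 2 ^ j) \<longlonglongrightarrow> 0"
      using LIMSEQ_divide_realpow_zero[of 2 B] by simp
    then have "(\<lambda>j. ?F + ennreal (B / 2 ^ j)) \<longlonglongrightarrow> ?F + ennreal 0"
      by (intro tendsto_add tendsto_const tendsto_ennrealI)
    then show "(\<lambda>j. ?F + ennreal (B / 2 ^ j)) \<longlonglongrightarrow> ?F" by simp
    show "\<exists>N. \<forall>j\<ge>N. ennreal (\<theta>^2) * jump_iter \<theta> E u g i (\<lambda>q. w q - u e q) \<le> ?F + ennreal (B / 2 ^ j)"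
    proof (intro exI allI impI)
      fix j assume "i \<le> j"
      then have "ennreal (\<theta>^2) * jump_iter \<theta> E u g i (\<lambda>q. w q - u e q)
          \<le> ennreal (\<theta>^2) * jump_iter \<theta> E u g j (\<lambda>q. w q - u e q)"
        by (intro mult_left_mono incseqD[OF incseq_jump_iter]) auto
      also have "\<dots> \<le> jump_iter \<theta> E u g j w + ennreal (B / 2 ^ j)"
        by (rule jump_iter_translate_le) (use assms in auto)
      also have "\<dots> \<le> ?F + ennreal (B / 2 ^ j)"
        unfolding jump_density_def by (intro add_right_mono SUP_upper) auto
      finally show "ennreal (\<theta>^2) * jump_iter \<theta> E u g i (\<lambda>q. w q - u e q) \<le> ?F + ennreal (B / 2 ^ j)" .
    qed
  qed
  then show ?thesis
    unfolding jump_density_def by (subst SUP_mult_left_ennreal) (auto intro: SUP_least)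
qed

section \<open>Integrals over real vectors\<close>

abbreviation lborel_prod :: "'q set \<Rightarrow> ('q \<Rightarrow> real) measure"
  where "lborel_prod Q \<equiv> Pi\<^sub>M Q (\<lambda>_. lborel)"

text \<open>Points of the product space are \<open>undefined\<close> outside \<open>Q\<close>; a
  shift that is zero there keeps them in the space. The same condition recurs for every shift
  below.\<close>

lemma measurable_translate:
  assumes "\<And>q. q \<notin> Q \<Longrightarrow> v q = 0"
  shows "(\<lambda>w q. w q - v q) \<in> measurable (lborel_prod Q) (lborel_prod Q)"
proof (rule measurable_PiM_single')
  show "(\<lambda>w. w q - v q) \<in> lborel_prod Q \<rightarrow>\<^sub>M lborel" if "q \<in> Q" for q
    using that by measurable
  show "(\<lambda>w q. w q - v q) \<in> space (lborel_prod Q) \<rightarrow> (\<Pi>\<^sub>E i\<in>Q. space lborel)"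
    using assms by (auto simp: space_PiM PiE_iff extensional_def)
qed

lemma distr_translate:
  assumes Q: "finite Q" and v: "\<And>q. q \<notin> Q \<Longrightarrow> v q = 0"
  shows "distr (lborel_prod Q) (lborel_prod Q) (\<lambda>w q. w q - v q) = lborel_prod Q"
proof -
  interpret product_sigma_finite "\<lambda>_. lborel :: real measure" by standard
  show ?thesis
  proof (rule PiM_eqI[OF Q])
    fix A :: "'a \<Rightarrow> real set" assume A: "\<And>i. i \<in> Q \<Longrightarrow> A i \<in> sets lborel"
    have pre: "(\<lambda>x. x - v i) -` A i \<in> sets lborel" if "i \<in> Q" for i
    proof -
      have "(\<lambda>x. x - v i) \<in> borel_measurable borel" by measurable
      from measurable_sets[OF this, of "A i"] show ?thesis using A[OF that] by simp
    qed
    have one: "emeasure lborel ((\<lambda>x. x - v i) -` A i) = emeasure lborel (A i)" if "i \<in> Q" for i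
    proof -
      have "emeasure lborel (A i) = emeasure (distr lborel borel ((+) (- v i))) (A i)"
        by (simp add: lborel_distr_plus)
      also have "\<dots> = emeasure lborel ((+) (- v i) -` A i)"
        using A[OF that] by (subst emeasure_distr) auto
      also have "(+) (- v i) -` A i = (\<lambda>x. x - v i) -` A i" by auto
      finally show ?thesis by simp
    qed
    have "(\<lambda>w q. w q - v q) -` Pi\<^sub>E Q A \<inter> space (lborel_prod Q) = Pi\<^sub>E Q (\<lambda>i. (\<lambda>x. x - v i) -` A i)"
      using v by (auto simp: space_PiM PiE_iff extensional_def)
    then have "emeasure (distr (lborel_prod Q) (lborel_prod Q) (\<lambda>w q. w q - v q)) (Pi\<^sub>E Q A)
        = emeasure (lborel_prod Q) (Pi\<^sub>E Q (\<lambda>i. (\<lambda>x. x - v i) -` A i))"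
      using A Q by (subst emeasure_distr[OF measurable_translate[OF v]]) (auto intro!: sets_PiM_I_finite)
    also have "\<dots> = (\<Prod>i\<in>Q. emeasure lborel (A i))"
      using pre one by (subst emeasure_PiM[OF Q]) auto
    finally show "emeasure (distr (lborel_prod Q) (lborel_prod Q) (\<lambda>w q. w q - v q)) (Pi\<^sub>E Q A)
        = (\<Prod>i\<in>Q. emeasure lborel (A i))" .
  qed simp
qed

lemma measurable_compose_translate:
  assumes "f \<in> measurable (lborel_prod Q) N" and "\<And>q. q \<notin> Q \<Longrightarrow> v q = 0"
  shows "(\<lambda>w. f (\<lambda>q. w q - v q)) \<in> measurable (lborel_prod Q) N"
  using measurable_compose[OF measurable_translate[OF assms(2)] assms(1)] by simp

lemma nn_integral_translate:
  assumes "finite Q" and "f \<in> borel_measurable (lborel_prod Q)" and "\<And>q. q \<notin> Q \<Longrightarrow> v q = 0"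
  shows "(\<integral>\<^sup>+w. f (\<lambda>q. w q - v q) \<partial>lborel_prod Q) = (\<integral>\<^sup>+w. f w \<partial>lborel_prod Q)"
proof -
  have "integral\<^sup>N (distr (lborel_prod Q) (lborel_prod Q) (\<lambda>w q. w q - v q)) f
      = (\<integral>\<^sup>+w. f (\<lambda>q. w q - v q) \<partial>lborel_prod Q)"
    using assms by (subst nn_integral_distr[OF measurable_translate]) auto
  then show ?thesis
    by (simp add: distr_translate[OF assms(1,3)])
qed

lemma borel_measurable_ray_avg:
  assumes "f \<in> borel_measurable (lborel_prod Q)" and "\<And>q. q \<notin> Q \<Longrightarrow> u q = 0"
  shows "ray_avg \<theta> u f \<in> borel_measurable (lborel_prod Q)"
  unfolding ray_avg_def
  using assms by (intro borel_measurable_suminf_order borel_measurable_times measurable_compose_translate) auto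

lemma nn_integral_ray_avg:
  assumes \<theta>: "0 < \<theta>" "\<theta> < 1" and Q: "finite Q"
    and f: "f \<in> borel_measurable (lborel_prod Q)" and u: "\<And>q. q \<notin> Q \<Longrightarrow> u q = 0"
  shows "(\<integral>\<^sup>+w. ray_avg \<theta> u f w \<partial>lborel_prod Q) = (\<integral>\<^sup>+w. f w \<partial>lborel_prod Q)"
proof -
  have m: "(\<lambda>w. f (\<lambda>q. w q - real c * u q)) \<in> borel_measurable (lborel_prod Q)" for c
    using u by (intro measurable_compose_translate f) auto
  have "(\<integral>\<^sup>+w. ray_avg \<theta> u f w \<partial>lborel_prod Q)
      = (\<Sum>c. ennreal ((1 - \<theta>) * \<theta> ^ c) * (\<integral>\<^sup>+w. f (\<lambda>q. w q - real c * u q) \<partial>lborel_prod Q))"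
    unfolding ray_avg_def using m by (simp add: nn_integral_suminf nn_integral_cmult)
  also have "\<dots> = (\<Sum>c. ennreal ((1 - \<theta>) * \<theta> ^ c) * (\<integral>\<^sup>+w. f w \<partial>lborel_prod Q))"
    using u by (simp add: nn_integral_translate[OF Q f])
  finally show ?thesis
    by (simp add: suminf_geometric_weights[OF \<theta>])
qed

text \<open>Moving the shift from \<open>f\<close> to \<open>H\<close> turns the \<open>c\<close>-th
  term into an integral of \<open>H\<close> at \<open>w + c u\<close>, which exceeds
  \<open>H w\<close> by at most \<open>c * b\<close>; the mean of \<open>c\<close> is
  \<open>\<theta> / (1 - \<theta>)\<close>.\<close>

lemma nn_integral_ray_avg_mult_le:
  assumes \<theta>: "0 < \<theta>" "\<theta> < 1" and Q: "finite Q"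
    and f: "f \<in> borel_measurable (lborel_prod Q)" and u: "\<And>q. q \<notin> Q \<Longrightarrow> u q = 0"
    and H: "H \<in> borel_measurable (lborel_prod Q)"
    and lip: "\<And>c w. H (\<lambda>q. w q + real c * u q) \<le> H w + ennreal (real c) * b"
  shows "(\<integral>\<^sup>+w. ray_avg \<theta> u f w * H w \<partial>lborel_prod Q)
    \<le> (\<integral>\<^sup>+w. f w * H w \<partial>lborel_prod Q) + ennreal (\<theta> / (1 - \<theta>)) * b * (\<integral>\<^sup>+w. f w \<partial>lborel_prod Q)"
proof -
  note [measurable] = f H
  have m[measurable]: "(\<lambda>w. f (\<lambda>q. w q - real c * u q)) \<in> borel_measurable (lborel_prod Q)" for c
    using u by (intro measurable_compose_translate f) auto
  have Hm[measurable]: "(\<lambda>w. H (\<lambda>q. w q + real c * u q)) \<in> borel_measurable (lborel_prod Q)" for c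
    using measurable_compose_translate[OF H, of "\<lambda>q. - (real c * u q)"] u by simp
  have "(\<integral>\<^sup>+w. ray_avg \<theta> u f w * H w \<partial>lborel_prod Q)
      = (\<integral>\<^sup>+w. (\<Sum>c. ennreal ((1 - \<theta>) * \<theta> ^ c) * (f (\<lambda>q. w q - real c * u q) * H w)) \<partial>lborel_prod Q)"
    unfolding ray_avg_def by (simp add: mult.assoc flip: ennreal_suminf_multc)
  also have "\<dots> = (\<Sum>c. ennreal ((1 - \<theta>) * \<theta> ^ c) * (\<integral>\<^sup>+w. f (\<lambda>q. w q - real c * u q) * H w \<partial>lborel_prod Q))"
    by (simp add: nn_integral_suminf nn_integral_cmult)
  also have "\<dots> = (\<Sum>c. ennreal ((1 - \<theta>) * \<theta> ^ c) * (\<integral>\<^sup>+w. f w * H (\<lambda>q. w q + real c * u q) \<partial>lborel_prod Q))"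
  proof (intro suminf_cong arg_cong2[where f = "(*)"] refl)
    fix c
    show "(\<integral>\<^sup>+w. f (\<lambda>q. w q - real c * u q) * H w \<partial>lborel_prod Q)
        = (\<integral>\<^sup>+w. f w * H (\<lambda>q. w q + real c * u q) \<partial>lborel_prod Q)"
      using nn_integral_translate[OF Q, of "\<lambda>w. f w * H (\<lambda>q. w q + real c * u q)" "\<lambda>q. real c * u q"] u
      by simp
  qed
  also have "\<dots> \<le> (\<Sum>c. ennreal ((1 - \<theta>) * \<theta> ^ c) * ((\<integral>\<^sup>+w. f w * H w \<partial>lborel_prod Q)
      + ennreal (real c) * (b * (\<integral>\<^sup>+w. f w \<partial>lborel_prod Q))))"
  proof (intro suminf_le mult_left_mono)
    fix c
    have "(\<integral>\<^sup>+w. f w * H (\<lambda>q. w q + real c * u q) \<partial>lborel_prod Q)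
        \<le> (\<integral>\<^sup>+w. f w * H w + (ennreal (real c) * b) * f w \<partial>lborel_prod Q)"
    proof (intro nn_integral_mono)
      fix w
      have "f w * H (\<lambda>q. w q + real c * u q) \<le> f w * (H w + ennreal (real c) * b)"
        by (intro mult_left_mono lip) auto
      then show "f w * H (\<lambda>q. w q + real c * u q) \<le> f w * H w + (ennreal (real c) * b) * f w"
        by (simp add: distrib_left mult_ac)
    qed
    also have "\<dots> = (\<integral>\<^sup>+w. f w * H w \<partial>lborel_prod Q) + ennreal (real c) * (b * (\<integral>\<^sup>+w. f w \<partial>lborel_prod Q))"
      by (subst nn_integral_add) (auto simp: nn_integral_cmult mult.assoc)
    finally show "(\<integral>\<^sup>+w. f w * H (\<lambda>q. w q + real c * u q) \<partial>lborel_prod Q) \<le> \<dots>" .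
  qed auto
  also have "\<dots> = (\<Sum>c. ennreal ((1 - \<theta>) * \<theta> ^ c) * (\<integral>\<^sup>+w. f w * H w \<partial>lborel_prod Q))
      + (\<Sum>c. ennreal ((1 - \<theta>) * \<theta> ^ c) * ennreal (real c) * (b * (\<integral>\<^sup>+w. f w \<partial>lborel_prod Q)))"
    by (subst suminf_add) (auto simp: distrib_left mult_ac)
  also have "\<dots> = (\<integral>\<^sup>+w. f w * H w \<partial>lborel_prod Q) + ennreal (\<theta> / (1 - \<theta>)) * (b * (\<integral>\<^sup>+w. f w \<partial>lborel_prod Q))"
    by (simp only: ennreal_suminf_multc suminf_geometric_weights[OF \<theta>] suminf_geometric_mean[OF \<theta>] mult_1)
  finally show ?thesis by (simp add: mult_ac)
qed

section \<open>Mass and moments of the jump density\<close>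

lemma borel_measurable_jump_iter:
  assumes g: "g \<in> borel_measurable (lborel_prod Q)" and u: "\<And>e q. e \<in> E \<Longrightarrow> q \<notin> Q \<Longrightarrow> u e q = 0"
  shows "jump_iter \<theta> E u g j \<in> borel_measurable (lborel_prod Q)"
proof (induction j)
  case (Suc j)
  note g[measurable]
  have [measurable]: "ray_avg \<theta> (u e) (jump_iter \<theta> E u g j) \<in> borel_measurable (lborel_prod Q)" if "e \<in> E" for e
    using that by (intro borel_measurable_ray_avg Suc u)
  show ?case unfolding jump_iter.simps by measurable
qed (use g in simp)

lemma borel_measurable_jump_density:
  assumes g: "g \<in> borel_measurable (lborel_prod Q)" and u: "\<And>e q. e \<in> E \<Longrightarrow> q \<notin> Q \<Longrightarrow> u e q = 0"
  shows "jump_density \<theta> E u g \<in> borel_measurable (lborel_prod Q)"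
  unfolding jump_density_def
  using borel_measurable_jump_iter[OF assms] by (auto intro!: borel_measurable_SUP)

lemma ennreal_mean_weight:
  assumes "finite E" "E \<noteq> {}"
  shows "ennreal (1 / (2 * card E)) * (\<Sum>e\<in>E. c) = ennreal (1 / 2) * c"
proof -
  have "ennreal (1 / (2 * card E)) * of_nat (card E) = ennreal (1 / 2)"
    using assms by (auto simp: ennreal_of_nat_eq_real_of_nat simp flip: ennreal_mult)
  then show ?thesis by (simp flip: mult.assoc)
qed

text \<open>Ray averages preserve mass, so each iteration sends the mass \<open>x\<close> to
  \<open>1 / 2 + x / 2\<close>.\<close>

lemma nn_integral_jump_iter:
  assumes \<theta>: "0 < \<theta>" "\<theta> < 1" and Q: "finite Q" and E: "finite E" "E \<noteq> {}"
    and g[measurable]: "g \<in> borel_measurable (lborel_prod Q)" and u: "\<And>e q. e \<in> E \<Longrightarrow> q \<notin> Q \<Longrightarrow> u e q = 0"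
    and mass: "(\<integral>\<^sup>+w. g w \<partial>lborel_prod Q) = ennreal (1 / 2)"
  shows "(\<integral>\<^sup>+w. jump_iter \<theta> E u g j w \<partial>lborel_prod Q) = ennreal (1 - (1 / 2) ^ Suc j)"
proof (induction j)
  case 0
  then show ?case by (simp add: mass)
next
  case (Suc j)
  have F: "jump_iter \<theta> E u g j \<in> borel_measurable (lborel_prod Q)"
    by (rule borel_measurable_jump_iter[OF g u])
  have [measurable]: "ray_avg \<theta> (u e) (jump_iter \<theta> E u g j) \<in> borel_measurable (lborel_prod Q)" if "e \<in> E" for e
    using that by (intro borel_measurable_ray_avg F u)
  have "(\<integral>\<^sup>+w. jump_iter \<theta> E u g (Suc j) w \<partial>lborel_prod Q)
      = ennreal (1 / 2) + ennreal (1 / (2 * card E)) *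
        (\<Sum>e\<in>E. \<integral>\<^sup>+w. ray_avg \<theta> (u e) (jump_iter \<theta> E u g j) w \<partial>lborel_prod Q)"
    unfolding jump_iter.simps
    by (subst nn_integral_add) (auto simp: nn_integral_cmult nn_integral_sum mass)
  also have "\<dots> = ennreal (1 / 2) + ennreal (1 / (2 * card E)) * (\<Sum>e\<in>E. ennreal (1 - (1 / 2) ^ Suc j))"
    using u by (simp add: nn_integral_ray_avg[OF \<theta> Q F] Suc cong: sum.cong)
  also have "\<dots> = ennreal (1 / 2) + ennreal (1 / 2) * ennreal (1 - (1 / 2) ^ Suc j)"
    by (simp only: ennreal_mean_weight[OF E])
  also have "\<dots> = ennreal (1 / 2 + 1 / 2 * (1 - (1 / 2) ^ Suc j))"
    using ennreal_plus[of "1 / 2" "1 / 2 * (1 - (1 / 2) ^ Suc j)"] ennreal_mult[of "1 / 2" "1 - (1 / 2) ^ Suc j"]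
    by (simp only: power_le_one[of "1 / 2 :: real"] diff_ge_0_iff_ge mult_nonneg_nonneg)
  also have "1 / 2 + 1 / 2 * (1 - (1 / 2) ^ Suc j) = (1 - (1 / 2) ^ Suc (Suc j) :: real)"
    by (simp add: field_simps)
  finally show ?case .
qed

lemma nn_integral_jump_density:
  assumes \<theta>: "0 < \<theta>" "\<theta> < 1" and Q: "finite Q" and E: "finite E" "E \<noteq> {}"
    and g: "g \<in> borel_measurable (lborel_prod Q)" and u: "\<And>e q. e \<in> E \<Longrightarrow> q \<notin> Q \<Longrightarrow> u e q = 0"
    and mass: "(\<integral>\<^sup>+w. g w \<partial>lborel_prod Q) = ennreal (1 / 2)"
  shows "(\<integral>\<^sup>+w. jump_density \<theta> E u g w \<partial>lborel_prod Q) = 1"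
proof (rule LIMSEQ_unique)
  have inc: "incseq (\<lambda>j. jump_iter \<theta> E u g j)"
    using incseqD[OF incseq_jump_iter] by (auto simp: incseq_def le_fun_def)
  have "(\<integral>\<^sup>+w. jump_density \<theta> E u g w \<partial>lborel_prod Q) = (SUP j. \<integral>\<^sup>+w. jump_iter \<theta> E u g j w \<partial>lborel_prod Q)"
    unfolding jump_density_def
    by (rule nn_integral_monotone_convergence_SUP[OF inc borel_measurable_jump_iter[OF g u]])
  moreover have "incseq (\<lambda>j. \<integral>\<^sup>+w. jump_iter \<theta> E u g j w \<partial>lborel_prod Q)"
    by (intro incseq_SucI nn_integral_mono jump_iter_mono_Suc)
  ultimately show "(\<lambda>j. \<integral>\<^sup>+w. jump_iter \<theta> E u g j w \<partial>lborel_prod Q)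
      \<longlonglongrightarrow> (\<integral>\<^sup>+w. jump_density \<theta> E u g w \<partial>lborel_prod Q)"
    by (simp add: LIMSEQ_SUP)
  have "(\<lambda>j. (1 / 2 :: real) ^ Suc j) \<longlonglongrightarrow> 0"
    by (intro LIMSEQ_Suc LIMSEQ_realpow_zero) auto
  then have "(\<lambda>j. ennreal (1 - (1 / 2) ^ Suc j)) \<longlonglongrightarrow> ennreal (1 - 0)"
    by (intro tendsto_ennrealI tendsto_diff tendsto_const)
  then show "(\<lambda>j. \<integral>\<^sup>+w. jump_iter \<theta> E u g j w \<partial>lborel_prod Q) \<longlonglongrightarrow> 1"
    by (subst nn_integral_jump_iter[OF assms]) simp_all
qed

text \<open>The factor 2 normalizes \<open>g\<close> to mass 1. The mean number of jumps is 1, and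
  one jump raises \<open>H\<close> by at most \<open>\<theta> / (1 - \<theta>) * b\<close> on
  average.\<close>

lemma nn_integral_jump_density_mult_le:
  assumes \<theta>: "0 < \<theta>" "\<theta> < 1" and Q: "finite Q" and E: "finite E" "E \<noteq> {}"
    and g[measurable]: "g \<in> borel_measurable (lborel_prod Q)" and u: "\<And>e q. e \<in> E \<Longrightarrow> q \<notin> Q \<Longrightarrow> u e q = 0"
    and mass: "(\<integral>\<^sup>+w. g w \<partial>lborel_prod Q) = ennreal (1 / 2)"
    and H[measurable]: "H \<in> borel_measurable (lborel_prod Q)"
    and lip: "\<And>e c w. e \<in> E \<Longrightarrow> H (\<lambda>q. w q + real c * u e q) \<le> H w + ennreal (real c) * b"
  shows "(\<integral>\<^sup>+w. jump_density \<theta> E u g w * H w \<partial>lborel_prod Q)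
    \<le> 2 * (\<integral>\<^sup>+w. g w * H w \<partial>lborel_prod Q) + ennreal (\<theta> / (1 - \<theta>)) * b"
proof -
  let ?m = "\<integral>\<^sup>+w. g w * H w \<partial>lborel_prod Q" and ?k = "ennreal (\<theta> / (1 - \<theta>)) * b"
  have F[measurable]: "jump_iter \<theta> E u g j \<in> borel_measurable (lborel_prod Q)" for j
    by (rule borel_measurable_jump_iter[OF g u])
  have two: "ennreal (1 / 2) * (2 * x) = x" for x
  proof -
    have "ennreal (1 / 2) * ennreal 2 = 1"
      by (subst ennreal_mult[symmetric]) auto
    then show ?thesis by (simp only: mult.assoc[symmetric] ennreal_numeral mult_1)
  qed
  \<comment> \<open>The moments obey the recursion \<open>X \<mapsto> ?m + (X + ?k) / 2\<close>,
    whose fixed point is \<open>2 * ?m + ?k\<close>; the induction therefore never leaves this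
    bound.\<close>
  have "(\<integral>\<^sup>+w. jump_iter \<theta> E u g j w * H w \<partial>lborel_prod Q) \<le> 2 * ?m + ?k" for j
  proof (induction j)
    case 0
    have "?m \<le> ?m + (?m + ?k)" by simp
    then show ?case by (simp add: mult_2 add.assoc)
  next
    case (Suc j)
    let ?F = "jump_iter \<theta> E u g j"
    have [measurable]: "ray_avg \<theta> (u e) ?F \<in> borel_measurable (lborel_prod Q)" if "e \<in> E" for e
      using that by (intro borel_measurable_ray_avg F u)
    have "(\<integral>\<^sup>+w. jump_iter \<theta> E u g (Suc j) w * H w \<partial>lborel_prod Q)
      = (\<integral>\<^sup>+w. g w * H w + ennreal (1 / (2 * card E)) * (\<Sum>e\<in>E. ray_avg \<theta> (u e) ?F w * H w) \<partial>lborel_prod Q)"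
      by (simp add: distrib_right sum_distrib_right mult.assoc)
    also have "\<dots> = ?m + ennreal (1 / (2 * card E)) * (\<Sum>e\<in>E. \<integral>\<^sup>+w. ray_avg \<theta> (u e) ?F w * H w \<partial>lborel_prod Q)"
      by (subst nn_integral_add) (auto simp: nn_integral_cmult nn_integral_sum)
    also have "\<dots> \<le> ?m + ennreal (1 / (2 * card E)) * (\<Sum>e\<in>E. 2 * ?m + ?k + ?k)"
    proof (intro add_left_mono mult_left_mono sum_mono)
      fix e assume e: "e \<in> E"
      have "(\<integral>\<^sup>+w. ray_avg \<theta> (u e) ?F w * H w \<partial>lborel_prod Q)
          \<le> (\<integral>\<^sup>+w. ?F w * H w \<partial>lborel_prod Q) + ?k * (\<integral>\<^sup>+w. ?F w \<partial>lborel_prod Q)"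
        using e by (intro nn_integral_ray_avg_mult_le[OF \<theta> Q F u H lip])
      also have "\<dots> \<le> (2 * ?m + ?k) + ?k * 1"
        by (intro add_mono Suc mult_left_mono)
          (auto simp: nn_integral_jump_iter[OF \<theta> Q E g u mass] ennreal_le_1 simp del: power_Suc)
      finally show "(\<integral>\<^sup>+w. ray_avg \<theta> (u e) ?F w * H w \<partial>lborel_prod Q) \<le> 2 * ?m + ?k + ?k" by simp
    qed simp
    also have "\<dots> = ?m + ennreal (1 / 2) * (2 * ?m + ?k + ?k)"
      by (simp only: ennreal_mean_weight[OF E])
    also have "2 * ?m + ?k + ?k = 2 * (?m + ?k)" by (simp only: mult_2 add_ac)
    also have "?m + ennreal (1 / 2) * (2 * (?m + ?k)) = ?m + (?m + ?k)" by (simp only: two)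
    also have "\<dots> = 2 * ?m + ?k" by (simp only: mult_2 add_ac)
    finally show ?case .
  qed
  moreover have "(\<integral>\<^sup>+w. jump_density \<theta> E u g w * H w \<partial>lborel_prod Q)
      = (SUP j. \<integral>\<^sup>+w. jump_iter \<theta> E u g j w * H w \<partial>lborel_prod Q)"
    unfolding jump_density_def SUP_mult_right_ennreal
    using incseqD[OF incseq_jump_iter, of _ _ \<theta> E u g]
    by (intro nn_integral_monotone_convergence_SUP) (auto simp: incseq_def le_fun_def intro!: mult_right_mono)
  ultimately show ?thesis by (auto intro: SUP_least)
qed

section \<open>Gaussian densities\<close>

definition gaussian_density :: "'q set \<Rightarrow> real \<Rightarrow> ('q \<Rightarrow> real) \<Rightarrow> real"
  where "gaussian_density Q V w = (\<Prod>q\<in>Q. normal_density 0 (sqrt V) (w q))"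

lemma gaussian_density_nonneg: "0 \<le> gaussian_density Q V w"
  unfolding gaussian_density_def by (intro prod_nonneg) auto

lemma borel_measurable_gaussian_density [measurable]:
  "gaussian_density Q V \<in> borel_measurable (lborel_prod Q)"
  unfolding gaussian_density_def by measurable

text \<open>Supplies a finite initial defect \<open>B\<close> for
  \<open>jump_density_translate_le\<close>; its size is irrelevant because it is halved in every
  iteration.\<close>

lemma gaussian_density_le:
  assumes "0 < V"
  shows "gaussian_density Q V w \<le> (1 / sqrt (2 * pi * V)) ^ card Q"
proof -
  have "gaussian_density Q V w \<le> (\<Prod>q\<in>Q. 1 / sqrt (2 * pi * V))"
    unfolding gaussian_density_def
  proof (intro prod_mono conjI)
    fix q
    have "1 / sqrt (2 * pi * V) * exp (- (w q)\<^sup>2 / (2 * V)) \<le> 1 / sqrt (2 * pi * V) * 1"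
      using assms by (intro mult_left_mono) auto
    then show "normal_density 0 (sqrt V) (w q) \<le> 1 / sqrt (2 * pi * V)"
      using assms by (simp add: normal_density_def)
  qed simp
  then show ?thesis by simp
qed

lemma gaussian_density_translate:
  assumes "0 < V"
  shows "gaussian_density Q V (\<lambda>q. w q - v q)
    = gaussian_density Q V w * exp ((\<Sum>q\<in>Q. w q * v q) / V - (\<Sum>q\<in>Q. (v q)\<^sup>2) / (2 * V))"
proof (cases "finite Q")
  case True
  have "normal_density 0 (sqrt V) (w q - v q)
      = normal_density 0 (sqrt V) (w q) * exp (w q * v q / V - (v q)\<^sup>2 / (2 * V))" for q
    using assms by (simp add: normal_density_def exp_add[symmetric] field_simps power2_eq_square)
  then show ?thesis
    using True by (simp add: gaussian_density_def prod.distrib sum_divide_distrib sum_subtractf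
        flip: exp_sum)
qed (simp add: gaussian_density_def)

lemma nn_integral_gaussian_density:
  assumes "finite Q" "0 < V"
  shows "(\<integral>\<^sup>+w. gaussian_density Q V w \<partial>lborel_prod Q) = 1"
proof -
  interpret product_sigma_finite "\<lambda>_. lborel :: real measure" by standard
  have one: "(\<integral>\<^sup>+x. normal_density 0 (sqrt V) x \<partial>lborel) = 1"
    using assms by (subst nn_integral_eq_integral) auto
  have "(\<integral>\<^sup>+w. gaussian_density Q V w \<partial>lborel_prod Q)
      = (\<integral>\<^sup>+w. (\<Prod>q\<in>Q. ennreal (normal_density 0 (sqrt V) (w q))) \<partial>lborel_prod Q)"
    by (simp add: gaussian_density_def prod_ennreal)
  also have "\<dots> = 1"
    using assms one by (subst product_nn_integral_prod) auto
  finally show ?thesis .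
qed

section \<open>Exponential moments and maxima of Gaussian linear forms\<close>

lemma nn_integral_gaussian_exp:
  assumes Q: "finite Q" and V: "0 < V" and v: "\<And>q. q \<notin> Q \<Longrightarrow> v q = 0"
  shows "(\<integral>\<^sup>+w. gaussian_density Q V w * exp (l * (\<Sum>q\<in>Q. w q * v q)) \<partial>lborel_prod Q)
    = ennreal (exp (l\<^sup>2 * V * (\<Sum>q\<in>Q. (v q)\<^sup>2) / 2))"
proof -
  let ?c = "exp (l\<^sup>2 * V * (\<Sum>q\<in>Q. (v q)\<^sup>2) / 2)"
  \<comment> \<open>Completing the square: the exponential tilt of the Gaussian is a constant times
    its shift by \<open>l * V * v\<close>.\<close>
  have *: "gaussian_density Q V w * exp (l * (\<Sum>q\<in>Q. w q * v q))
      = ?c * gaussian_density Q V (\<lambda>q. w q - l * V * v q)" for w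
  proof -
    have "(\<Sum>q\<in>Q. w q * (l * V * v q)) / V - (\<Sum>q\<in>Q. (l * V * v q)\<^sup>2) / (2 * V)
        = l * (\<Sum>q\<in>Q. w q * v q) - l\<^sup>2 * V * (\<Sum>q\<in>Q. (v q)\<^sup>2) / 2"
      using V by (simp add: sum_distrib_left sum_divide_distrib power_mult_distrib field_simps power2_eq_square)
    then show ?thesis
      by (simp add: gaussian_density_translate[OF V] exp_diff)
  qed
  have "(\<integral>\<^sup>+w. gaussian_density Q V w * exp (l * (\<Sum>q\<in>Q. w q * v q)) \<partial>lborel_prod Q)
      = (\<integral>\<^sup>+w. ennreal ?c * ennreal (gaussian_density Q V (\<lambda>q. w q - l * V * v q)) \<partial>lborel_prod Q)"
    unfolding * by (simp add: ennreal_mult gaussian_density_nonneg)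
  also have "\<dots> = ennreal ?c * (\<integral>\<^sup>+w. gaussian_density Q V (\<lambda>q. w q - l * V * v q) \<partial>lborel_prod Q)"
    using v by (intro nn_integral_cmult measurable_compose_translate[of "\<lambda>w. ennreal (gaussian_density Q V w)"]) auto
  also have "(\<integral>\<^sup>+w. gaussian_density Q V (\<lambda>q. w q - l * V * v q) \<partial>lborel_prod Q) = 1"
    using v by (subst nn_integral_translate[OF Q, of "\<lambda>w. ennreal (gaussian_density Q V w)"])
      (auto simp: nn_integral_gaussian_density[OF Q V])
  finally show ?thesis by simp
qed

text \<open>The maximum is bounded by a threshold plus a sum of exponentials over \<open>E\<close>,
  whose means are at most \<open>card E\<close> each by \<open>var\<close>. Since
  \<open>ennreal\<close> truncates at 0, the estimate is for the positive part of the
  maximum.\<close>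

lemma nn_integral_gaussian_SUP_le:
  assumes Q: "finite Q" and V: "0 < V" and E: "finite E" "E \<noteq> {}" and l: "0 < l"
    and v: "\<And>e q. e \<in> E \<Longrightarrow> q \<notin> Q \<Longrightarrow> v e q = 0"
    and var: "\<And>e. e \<in> E \<Longrightarrow> l\<^sup>2 * V * (\<Sum>q\<in>Q. (v e q)\<^sup>2) / 2 \<le> ln (card E)"
  shows "(\<integral>\<^sup>+w. ennreal (gaussian_density Q V w) * (SUP e\<in>E. ennreal (\<Sum>q\<in>Q. w q * v e q)) \<partial>lborel_prod Q)
    \<le> ennreal ((2 * ln (card E) + 1) / l)"
proof -
  define m where "m = real (card E)"
  have m: "m > 0" "m \<ge> 1" using E by (auto simp: m_def card_gt_0_iff Suc_le_eq)
  \<comment> \<open>\<open>x \<le> A + b * exp (l * x)\<close> is \<open>z \<le> exp z\<close> at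
    \<open>z = l * x - 2 * ln m\<close>. The threshold contains \<open>2 * ln m\<close> so that
    \<open>b\<close> has the factor \<open>1 / m^2\<close>, which cancels \<open>m\<close> terms of
    mean at most \<open>m\<close>.\<close>
  define A where "A = 2 * ln m / l"
  define b where "b = 1 / (l * m\<^sup>2)"
  have A: "A \<ge> 0" and b: "b \<ge> 0" using l m by (auto simp: A_def b_def)
  let ?\<gamma> = "gaussian_density Q V"
  have ptw: "ennreal (\<Sum>q\<in>Q. w q * v e q) \<le> ennreal (A + b * (\<Sum>e\<in>E. exp (l * (\<Sum>q\<in>Q. w q * v e q))))"
    if e: "e \<in> E" for w e
  proof (rule ennreal_leI)
    let ?x = "\<Sum>q\<in>Q. w q * v e q"
    have "l * ?x - 2 * ln m \<le> exp (l * ?x - 2 * ln m)"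
      using exp_ge_add_one_self[of "l * ?x - 2 * ln m"] by linarith
    also have "\<dots> = exp (l * ?x) / m\<^sup>2"
      using m by (simp add: exp_diff exp_double)
    finally have "?x \<le> A + b * exp (l * ?x)"
      using l by (simp add: A_def b_def field_simps)
    also have "\<dots> \<le> A + b * (\<Sum>e\<in>E. exp (l * (\<Sum>q\<in>Q. w q * v e q)))"
      using e E b by (intro add_left_mono mult_left_mono member_le_sum) auto
    finally show "?x \<le> \<dots>" .
  qed
  have "(\<integral>\<^sup>+w. ennreal (?\<gamma> w) * (SUP e\<in>E. ennreal (\<Sum>q\<in>Q. w q * v e q)) \<partial>lborel_prod Q)
      \<le> (\<integral>\<^sup>+w. ennreal A * ennreal (?\<gamma> w) + ennreal b * (\<Sum>e\<in>E. ennreal (?\<gamma> w * exp (l * (\<Sum>q\<in>Q. w q * v e q)))) \<partial>lborel_prod Q)"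
  proof (rule nn_integral_mono)
    fix w
    have "ennreal (?\<gamma> w) * (SUP e\<in>E. ennreal (\<Sum>q\<in>Q. w q * v e q))
        \<le> ennreal (?\<gamma> w) * ennreal (A + b * (\<Sum>e\<in>E. exp (l * (\<Sum>q\<in>Q. w q * v e q))))"
      by (intro mult_left_mono SUP_least ptw) auto
    also have "\<dots> = ennreal A * ennreal (?\<gamma> w) + ennreal b * (\<Sum>e\<in>E. ennreal (?\<gamma> w * exp (l * (\<Sum>q\<in>Q. w q * v e q))))"
    proof -
      have "?\<gamma> w * (A + b * (\<Sum>e\<in>E. exp (l * (\<Sum>q\<in>Q. w q * v e q))))
        = A * ?\<gamma> w + b * (\<Sum>e\<in>E. ?\<gamma> w * exp (l * (\<Sum>q\<in>Q. w q * v e q)))"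
        by (simp add: algebra_simps sum_distrib_left)
      moreover have "0 \<le> (\<Sum>e\<in>E. ?\<gamma> w * exp (l * (\<Sum>q\<in>Q. w q * v e q)))"
        by (intro sum_nonneg mult_nonneg_nonneg gaussian_density_nonneg) auto
      ultimately show ?thesis
        using A b gaussian_density_nonneg[of Q V w]
        by (subst ennreal_mult[symmetric]) (auto simp: sum_nonneg ennreal_mult[symmetric])
    qed
    finally show "ennreal (?\<gamma> w) * (SUP e\<in>E. ennreal (\<Sum>q\<in>Q. w q * v e q)) \<le> \<dots>" .
  qed
  also have "\<dots> = ennreal A + ennreal b * (\<Sum>e\<in>E. ennreal (exp (l\<^sup>2 * V * (\<Sum>q\<in>Q. (v e q)\<^sup>2) / 2)))"
    using v by (subst nn_integral_add)
      (auto simp: nn_integral_cmult nn_integral_sum nn_integral_gaussian_density[OF Q V] nn_integral_gaussian_exp[OF Q V])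
  also have "\<dots> \<le> ennreal A + ennreal b * (\<Sum>e\<in>E. ennreal m)"
  proof (intro add_left_mono mult_left_mono sum_mono ennreal_leI)
    fix e assume "e \<in> E"
    then have "exp (l\<^sup>2 * V * (\<Sum>q\<in>Q. (v e q)\<^sup>2) / 2) \<le> exp (ln m)"
      using var by (simp add: m_def)
    then show "exp (l\<^sup>2 * V * (\<Sum>q\<in>Q. (v e q)\<^sup>2) / 2) \<le> m" using m by simp
  qed simp
  also have "\<dots> = ennreal (A + b * (m * m))"
    using A b m by (simp add: m_def ennreal_mult ennreal_of_nat_eq_real_of_nat)
  also have "A + b * (m * m) = (2 * ln m + 1) / l"
    using m l by (simp add: A_def b_def field_simps power2_eq_square)
  finally show ?thesis by (simp add: m_def)
qed

section \<open>Gaussian privacy loss paid for by jumps\<close>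

text \<open>With \<open>y = <w, u> / V\<close> and \<open>\<eta> = |u|^2 / V\<close>,
  \<open>exp (c * y - c^2 * \<eta> / 2)\<close> is the factor by which the Gaussian density at
  \<open>w\<close> changes under the shift by \<open>c * u\<close>. Where one shift gains more than
  \<open>exp (2 * a)\<close>, shifts by \<open>N\<close> to \<open>2 * N - 1\<close> steps gain so
  much more that even with their geometric weights and the factor \<open>1 / (2 * m)\<close> they
  cover the excess.\<close>

lemma gaussian_source_inequality:
  fixes a y \<eta> :: real and N m :: nat
  assumes a: "0 < a" "a \<le> 1" and m: "2 \<le> m" and N: "4 * ln m \<le> N * a"
    and \<eta>: "0 \<le> \<eta>" "\<eta> \<le> a / (2 * N)"
  shows "exp (- a) ^ 2 * exp (y - \<eta> / 2)
    \<le> 1 + 1 / (2 * m) * ((1 - exp (- a)) *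
        (\<Sum>c\<in>{N..<2 * N}. (1 - exp (- a)) * exp (- a) ^ c * exp (c * y - (real c)\<^sup>2 * \<eta> / 2)))"
    (is "_ \<le> 1 + 1 / (2 * m) * ((1 - _) * ?S)")
proof -
  define t where "t = y - 2 * a"
  have lhs: "exp (- a) ^ 2 * exp (y - \<eta> / 2) \<le> exp t"
    using \<eta> by (simp add: t_def power2_eq_square flip: exp_add)
  have S0: "?S \<ge> 0"
    using a by (intro sum_nonneg mult_nonneg_nonneg) auto
  show ?thesis
  proof (cases "t \<le> 0")
    case True
    have "exp t \<le> 1" using True by simp
    also have "1 \<le> 1 + 1 / (2 * m) * ((1 - exp (- a)) * ?S)"
      using a S0 by simp
    finally show ?thesis using lhs by linarith
  next
    case False
    then have t: "t > 0" by simp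
    \<comment> \<open>From \<open>m \<ge> 2\<close>,
      \<open>N * a \<ge> 4 * ln 2 \<ge> 8 / 3\<close>, hence \<open>(N - 1) * a \<ge> 5 / 3\<close>.
      Their product 40/9 exceeds the 4 that two factors \<open>a / 2\<close> will cost.\<close>
    have "ln 2 \<le> ln (real m)" using m by simp
    then have Na: "8 / 3 \<le> N * a" using N ln2_ge_two_thirds by linarith
    then have N0: "N > 0" using gr0I by fastforce
    have N1: "5 / 3 \<le> (real N - 1) * a" using Na a by (simp add: algebra_simps)
    have big: "2 * real m \<le> exp (N * a / 2)"
    proof -
      have "2 * real m \<le> (real m)\<^sup>2" using m by (simp add: power2_eq_square)
      also have "\<dots> = exp (2 * ln m)" using m by (simp add: exp_double)
      also have "\<dots> \<le> exp (N * a / 2)" using N by simp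
      finally show ?thesis .
    qed
    have "1 + a \<le> exp a" by simp
    then have "exp (- a) \<le> 1 / (1 + a)"
      using a by (simp add: exp_minus field_simps)
    also have "\<dots> \<le> 1 - a / 2"
    proof -
      have "0 \<le> a * (1 - a)" using a by simp
      then show ?thesis using a by (simp add: field_simps)
    qed
    finally have \<theta>: "a / 2 \<le> 1 - exp (- a)" by simp
    have "N * ((1 - exp (- a)) * exp (N * a / 2 + N * t))
        = (\<Sum>c\<in>{N..<2 * N}. (1 - exp (- a)) * exp (N * a / 2 + N * t))" by simp
    also have "\<dots> \<le> ?S"
    proof (rule sum_mono)
      fix c assume c: "c \<in> {N..<2 * N}"
      \<comment> \<open>As \<open>c < 2 * N\<close>, the quadratic term costs at most
        \<open>c * a / 2\<close>, and the geometric weight costs \<open>c * a\<close>. Of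
        \<open>c * y = c * (t + 2 * a)\<close> at least \<open>c * (a / 2 + t)\<close> is
        left.\<close>
      have "real c * (real c * \<eta>) \<le> real c * (real (2 * N) * (a / (2 * N)))"
        using c \<eta> by (intro mult_left_mono mult_mono) auto
      also have "\<dots> = real c * a" using N0 by simp
      finally have "(real c)\<^sup>2 * \<eta> / 2 \<le> real c * a / 2" by (simp add: power2_eq_square)
      moreover have "real N * (a / 2 + t) \<le> real c * (a / 2 + t)"
        using c a t by (intro mult_right_mono) auto
      ultimately have "N * a / 2 + N * t \<le> - (c * a) + (c * y - (real c)\<^sup>2 * \<eta> / 2)"
        by (simp add: t_def algebra_simps)
      then have "exp (N * a / 2 + N * t) \<le> exp (- (c * a)) * exp (c * y - (real c)\<^sup>2 * \<eta> / 2)"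
        by (simp flip: exp_add)
      also have "exp (- (c * a)) = exp (- a) ^ c" by (simp flip: exp_of_nat_mult)
      finally show "(1 - exp (- a)) * exp (N * a / 2 + N * t)
          \<le> (1 - exp (- a)) * exp (- a) ^ c * exp (c * y - (real c)\<^sup>2 * \<eta> / 2)"
        using a by (simp add: mult.assoc)
    qed
    finally have S: "N * ((1 - exp (- a)) * exp (N * a / 2 + N * t)) \<le> ?S" .
    \<comment> \<open>From \<open>exp (N * t)\<close> one factor \<open>exp t\<close> is kept and
      the rest is bounded below by \<open>(N - 1) * t\<close>; the surplus
      \<open>exp (N * a / 2)\<close> has absorbed \<open>2 * m\<close>. What results suffices
      because \<open>exp t \<le> 1 + t * exp t\<close>.\<close>
    have "t * exp t \<le> (a / 2 * (a / 2) * (N * (real N - 1))) * (t * exp t)"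
    proof -
      have "1 \<le> (N * a) * ((real N - 1) * a) / 4"
        using mult_mono[OF Na N1] Na N1 by simp
      also have "\<dots> = a / 2 * (a / 2) * (N * (real N - 1))" by simp
      finally show ?thesis using t by simp
    qed
    also have "\<dots> = a / 2 * (a / 2) * (N * (exp t * ((real N - 1) * t)))" by simp
    also have "\<dots> \<le> (1 - exp (- a)) * (1 - exp (- a)) * (N * (exp t * exp ((real N - 1) * t)))"
    proof (intro mult_mono)
      show "(real N - 1) * t \<le> exp ((real N - 1) * t)"
        using exp_ge_add_one_self[of "(real N - 1) * t"] by linarith
    qed (use a \<theta> t N0 in auto)
    also have "exp t * exp ((real N - 1) * t) = exp (N * t)"
      by (simp add: algebra_simps flip: exp_add)
    also have "(1 - exp (- a)) * (1 - exp (- a)) * (N * exp (N * t))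
        = 1 / (2 * m) * ((1 - exp (- a)) * (N * ((1 - exp (- a)) * (2 * m * exp (N * t)))))"
      using m by simp
    also have "\<dots> \<le> 1 / (2 * m) * ((1 - exp (- a)) * (N * ((1 - exp (- a)) * (exp (N * a / 2) * exp (N * t)))))"
      using a big by (intro mult_left_mono mult_right_mono) auto
    also have "\<dots> \<le> 1 / (2 * m) * ((1 - exp (- a)) * ?S)"
      using S a by (intro mult_left_mono) (auto simp: exp_add)
    finally have "1 + t * exp t \<le> 1 + 1 / (2 * m) * ((1 - exp (- a)) * ?S)" by simp
    moreover have "exp t \<le> 1 + t * exp t"
    proof -
      have "(1 - t) * exp t \<le> exp (- t) * exp t"
        using exp_ge_add_one_self[of "- t"] by (intro mult_right_mono) auto
      then show ?thesis by (simp add: algebra_simps flip: exp_add)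
    qed
    ultimately show ?thesis using lhs by linarith
  qed
qed

lemma gaussian_density_source:
  fixes a V :: real and N m :: nat
  assumes a: "0 < a" "a \<le> 1" and m: "2 \<le> m" and N: "4 * ln m \<le> N * a"
    and V: "0 < V" and u: "(\<Sum>q\<in>Q. (u q)\<^sup>2) / V \<le> a / (2 * N)"
  defines "g \<equiv> \<lambda>w. ennreal (gaussian_density Q V w / 2)"
  shows "ennreal ((exp (- a))\<^sup>2) * g (\<lambda>q. w q - u q)
    \<le> g w + ennreal (1 / (2 * m)) * (ennreal (1 - exp (- a)) * ray_avg (exp (- a)) u g w)"
proof -
  define \<theta> where "\<theta> = exp (- a)"
  define y where "y = (\<Sum>q\<in>Q. w q * u q) / V"
  define \<eta> where "\<eta> = (\<Sum>q\<in>Q. (u q)\<^sup>2) / V"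
  define G where "G = gaussian_density Q V w / 2"
  have \<theta>: "0 < \<theta>" "\<theta> < 1" using a by (auto simp: \<theta>_def)
  have G: "0 \<le> G" by (simp add: G_def gaussian_density_nonneg)
  have shift: "g (\<lambda>q. w q - c * u q) = ennreal (G * exp (c * y - c\<^sup>2 * \<eta> / 2))" for c
    by (simp add: g_def gaussian_density_translate[OF V] G_def y_def \<eta>_def sum_distrib_left
        power_mult_distrib sum_divide_distrib mult_ac)
  let ?S = "\<Sum>c\<in>{N..<2 * N}. (1 - \<theta>) * \<theta> ^ c * exp (c * y - (real c)\<^sup>2 * \<eta> / 2)"
  have S0: "?S \<ge> 0"
    using \<theta> by (intro sum_nonneg mult_nonneg_nonneg) auto
  have "ennreal (G * ?S) = (\<Sum>c\<in>{N..<2 * N}. ennreal ((1 - \<theta>) * \<theta> ^ c) * g (\<lambda>q. w q - real c * u q))"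
    using \<theta> G unfolding shift
    by (simp add: sum_distrib_left mult_ac flip: ennreal_mult)
  \<comment> \<open>Of the whole ray only the window from \<open>N\<close> to
    \<open>2 * N - 1\<close> steps is kept.\<close>
  also have "\<dots> \<le> ray_avg \<theta> u g w"
    unfolding ray_avg_def by (intro sum_le_suminf) auto
  finally have S: "ennreal (G * ?S) \<le> ray_avg \<theta> u g w" .
  have "ennreal (\<theta>\<^sup>2) * g (\<lambda>q. w q - u q) = ennreal (G * (\<theta>\<^sup>2 * exp (y - \<eta> / 2)))"
    using shift[of 1] G \<theta> by (simp add: mult_ac flip: ennreal_mult)
  also have "\<dots> \<le> ennreal (G * (1 + 1 / (2 * m) * ((1 - \<theta>) * ?S)))"
  proof (intro ennreal_leI mult_left_mono G)
    show "\<theta>\<^sup>2 * exp (y - \<eta> / 2) \<le> 1 + 1 / (2 * m) * ((1 - \<theta>) * ?S)"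
      unfolding \<theta>_def using u V
      by (intro gaussian_source_inequality a m N) (auto simp: \<eta>_def intro!: divide_nonneg_nonneg sum_nonneg)
  qed
  also have "G * (1 + 1 / (2 * m) * ((1 - \<theta>) * ?S)) = G + 1 / (2 * m) * ((1 - \<theta>) * (G * ?S))"
    by (simp add: algebra_simps)
  also have "ennreal \<dots> = g w + ennreal (1 / (2 * m)) * (ennreal (1 - \<theta>) * ennreal (G * ?S))"
  proof -
    have *: "ennreal (G + r * (s * P)) = ennreal G + ennreal r * (ennreal s * ennreal P)"
      if "0 \<le> r" "0 \<le> s" "0 \<le> P" for r s P
      using that G by (simp add: ennreal_mult)
    show ?thesis
      unfolding g_def G_def[symmetric] using G S0 \<theta> by (intro *) auto
  qed
  also have "\<dots> \<le> g w + ennreal (1 / (2 * m)) * (ennreal (1 - \<theta>) * ray_avg \<theta> u g w)"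
    by (intro add_left_mono mult_left_mono S) auto
  finally show ?thesis by (simp add: \<theta>_def)
qed

section \<open>The noise density\<close>

lemma power_translate_le:
  fixes F :: "('q \<Rightarrow> real) \<Rightarrow> ennreal"
  assumes "\<And>w. b * F (\<lambda>q. w q - u q) \<le> F w"
  shows "b ^ j * F (\<lambda>q. w q - real j * u q) \<le> F w"
proof (induction j arbitrary: w)
  case (Suc j)
  have "b ^ Suc j * F (\<lambda>q. w q - real (Suc j) * u q) = b * (b ^ j * F (\<lambda>q. (w q - u q) - real j * u q))"
    by (simp add: algebra_simps)
  also have "\<dots> \<le> b * F (\<lambda>q. w q - u q)"
    by (intro mult_left_mono Suc) auto
  also have "\<dots> \<le> F w" by (rule assms)
  finally show ?case .
qed simp

lemma private_noise_density:
  fixes D :: "'d set" and Q :: "'q set" and v :: "'d \<Rightarrow> 'q \<Rightarrow> real" and \<epsilon> :: real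
  assumes D: "finite D" "D \<noteq> {}" and Q: "finite Q" "Q \<noteq> {}" and \<epsilon>: "0 < \<epsilon>"
    and v: "\<And>d q. d \<in> D \<Longrightarrow> \<bar>v d q\<bar> \<le> 1" and v0: "\<And>d q. q \<notin> Q \<Longrightarrow> v d q = 0"
  obtains F :: "('q \<Rightarrow> real) \<Rightarrow> ennreal" where
    "F \<in> borel_measurable (lborel_prod Q)"
    "(\<integral>\<^sup>+w. F w \<partial>lborel_prod Q) = 1"
    "\<forall>d\<in>D. \<forall>d'\<in>D. \<forall>w. F (\<lambda>q. w q - (v d q - v d' q)) \<le> ennreal (exp \<epsilon>) * F w"
    "(\<integral>\<^sup>+w. F w * (SUP e\<in>D \<times> {- 1, 1}. ennreal (\<Sum>q\<in>Q. w q * (snd e * v (fst e) q))) \<partial>lborel_prod Q)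
      \<le> ennreal (41 * ln (2 * real (card D)) * card Q / \<epsilon>)"
proof -
  define E :: "('d \<times> real) set" where "E = D \<times> {- 1, 1}"
  define k where "k = real (card Q)"
  define l where "l = ln (2 * real (card D))"
  \<comment> \<open>A shift by \<open>v d\<close> is made in \<open>R\<close> steps, each of which costs \<open>2 * a\<close>, with \<open>a\<close> bounded even if \<open>\<epsilon>\<close> is large.\<close>
  define R where "R = nat \<lceil>\<epsilon>\<rceil>"
  define a where "a = \<epsilon> / (4 * R)"
  \<comment> \<open>\<open>N\<close> and \<open>V\<close> are fitted to
    \<open>gaussian_density_source\<close>: \<open>4 * l \<le> N * a\<close> with
    \<open>l = ln (card E)\<close>, and \<open>|u e|^2 / V \<le> a / (2 * N)\<close> because
    \<open>|u e|^2 \<le> k / R^2\<close>.\<close>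
  define N where "N = nat \<lceil>4 * l / a\<rceil>"
  define V where "V = 2 * N * k / ((real R)\<^sup>2 * a)"
  define \<theta> where "\<theta> = exp (- a)"
  define u where "u = (\<lambda>e q. snd e * v (fst e) q / real R)"
  define g where "g = (\<lambda>w. ennreal (gaussian_density Q V w / 2))"
  define F where "F = jump_density \<theta> E u g"
  \<comment> \<open>Both signs occur in \<open>E\<close>, so this is the largest
    \<open>|<w, v d>|\<close>.\<close>
  define H where "H = (\<lambda>w. SUP e\<in>E. ennreal (\<Sum>q\<in>Q. w q * (snd e * v (fst e) q)))"
  have E: "finite E" "E \<noteq> {}" using D by (auto simp: E_def)
  have cE: "card E = 2 * card D" using D by (simp add: E_def card_cartesian_product)
  have cD: "card D \<ge> 1" using D by (simp add: Suc_le_eq card_gt_0_iff)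
  have k: "k \<ge> 1" using Q by (simp add: k_def Suc_le_eq card_gt_0_iff)
  have l: "l \<ge> 2 / 3"
  proof -
    have "ln 2 \<le> l" using cD by (simp add: l_def)
    then show ?thesis using ln2_ge_two_thirds by linarith
  qed
  have R: "R \<ge> 1" "\<epsilon> \<le> R" using \<epsilon> by (auto simp: R_def) linarith
  have a: "0 < a" "a \<le> 1 / 4" using R \<epsilon> by (auto simp: a_def field_simps)
  have Ra: "R * a = \<epsilon> / 4" using R by (simp add: a_def)
  have N: "4 * l \<le> N * a" "N * a \<le> 6 * l"
  proof -
    have "4 * l / a \<le> N" "N \<le> 4 * l / a + 1" using a l by (auto simp: N_def)
    then have "4 * l \<le> N * a" "N * a \<le> 4 * l + a" using a by (simp_all add: field_simps)
    then show "4 * l \<le> N * a" "N * a \<le> 6 * l" using a l by auto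
  qed
  have N0: "N > 0" using N l gr0I by fastforce
  have V: "V > 0" using N0 k R a by (simp add: V_def)
  have Vk: "V = 32 * (N * a) * k / \<epsilon>\<^sup>2"
    using R \<epsilon> by (simp add: V_def a_def field_simps power2_eq_square)
  have \<theta>: "0 < \<theta>" "\<theta> < 1" using a by (auto simp: \<theta>_def)
  have v1: "\<bar>snd e * v (fst e) q\<bar> \<le> 1" if "e \<in> E" for e q
    using that v by (auto simp: E_def)
  have v2: "(\<Sum>q\<in>Q. (snd e * v (fst e) q)\<^sup>2) \<le> k" if "e \<in> E" for e
    unfolding k_def using sum_bounded_above[of Q "\<lambda>q. (snd e * v (fst e) q)\<^sup>2" 1] v1[OF that]
    by (simp add: abs_square_le_1)
  have u0: "u e q = 0" if "q \<notin> Q" for e q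
    using that v0 by (simp add: u_def)
  have u2: "(\<Sum>q\<in>Q. (u e q)\<^sup>2) / V \<le> a / (2 * N)" if "e \<in> E" for e
  proof -
    have "(\<Sum>q\<in>Q. (u e q)\<^sup>2) = (\<Sum>q\<in>Q. (snd e * v (fst e) q)\<^sup>2) / (real R)\<^sup>2"
      by (simp add: u_def power_divide sum_divide_distrib)
    also have "\<dots> \<le> k / (real R)\<^sup>2"
      using v2[OF that] by (intro divide_right_mono) auto
    also have "\<dots> = a / (2 * N) * V" using R a N0 by (simp add: V_def)
    finally show ?thesis using V by (simp add: pos_divide_le_eq)
  qed
  have g[measurable]: "g \<in> borel_measurable (lborel_prod Q)"
    unfolding g_def by measurable
  have half: "g w = ennreal (1 / 2) * ennreal (gaussian_density Q V w)" for w
    using ennreal_mult[of "1 / 2" "gaussian_density Q V w"] gaussian_density_nonneg[of Q V w] by (simp add: g_def)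
  have mass: "(\<integral>\<^sup>+w. g w \<partial>lborel_prod Q) = ennreal (1 / 2)"
    unfolding half by (subst nn_integral_cmult) (auto simp: nn_integral_gaussian_density[OF Q(1) V])
  have H[measurable]: "H \<in> borel_measurable (lborel_prod Q)"
    unfolding H_def using E by (intro borel_measurable_SUP countable_finite) auto
  show thesis
  proof (rule that)
    show "F \<in> borel_measurable (lborel_prod Q)"
      unfolding F_def by (rule borel_measurable_jump_density[OF g u0])
    show "(\<integral>\<^sup>+w. F w \<partial>lborel_prod Q) = 1"
      unfolding F_def by (rule nn_integral_jump_density[OF \<theta> Q(1) E g u0 mass])
  next
    have step: "ennreal (\<theta>\<^sup>2) * F (\<lambda>q. w q - u e q) \<le> F w" if e: "e \<in> E" for e w
      unfolding F_def
    proof (rule jump_density_translate_le[OF E(1) e \<theta>])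
      show "ennreal (\<theta>\<^sup>2) * g (\<lambda>q. w q - u e q)
          \<le> g w + ennreal (1 / (2 * card E)) * (ennreal (1 - \<theta>) * ray_avg \<theta> (u e) g w)" for w
        unfolding \<theta>_def g_def
        by (rule gaussian_density_source[OF a(1) _ _ _ V u2[OF e]]) (use a cD N(1) in \<open>auto simp: cE l_def\<close>)
      show "g w \<le> ennreal ((1 / sqrt (2 * pi * V)) ^ card Q)" for w
        using gaussian_density_le[OF V, of Q w] gaussian_density_nonneg[of Q V w]
        unfolding g_def by (intro ennreal_leI) linarith
    qed (use V in auto)
    \<comment> \<open>\<open>R\<close> steps of \<open>1 / R\<close> make up one full vector and
      cost \<open>\<theta>^(2 * R) = exp (- \<epsilon> / 2)\<close>.\<close>
    have far: "ennreal (\<theta>\<^sup>2) ^ R * F (\<lambda>q. w q - s * v d q) \<le> F w" if "d \<in> D" "s \<in> {- 1, 1}" for d s w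
      using power_translate_le[of "ennreal (\<theta>\<^sup>2)" F "u (d, s)" R w, OF step] that R by (simp add: E_def u_def)
    show "\<forall>d\<in>D. \<forall>d'\<in>D. \<forall>w. F (\<lambda>q. w q - (v d q - v d' q)) \<le> ennreal (exp \<epsilon>) * F w"
    proof (intro ballI allI)
      fix d d' w assume d: "d \<in> D" "d' \<in> D"
      \<comment> \<open>The exchange is made in two legs, one by \<open>- v d'\<close> and one by
        \<open>v d\<close>, each using half of \<epsilon>.\<close>
      have "ennreal (\<theta>\<^sup>2) ^ R * (ennreal (\<theta>\<^sup>2) ^ R * F (\<lambda>q. w q - (v d q - v d' q)))
          \<le> ennreal (\<theta>\<^sup>2) ^ R * F (\<lambda>q. w q - v d q)"
        using far[OF d(2), of "- 1" "\<lambda>q. w q - v d q"] by (intro mult_left_mono) (auto simp: algebra_simps)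
      also have "\<dots> \<le> F w" using far[OF d(1), of 1 w] by simp
      finally have "ennreal (exp \<epsilon>) * (ennreal (\<theta>\<^sup>2) ^ R * (ennreal (\<theta>\<^sup>2) ^ R * F (\<lambda>q. w q - (v d q - v d' q))))
          \<le> ennreal (exp \<epsilon>) * F w"
        by (intro mult_left_mono) auto
      moreover have "ennreal (exp \<epsilon>) * (ennreal (\<theta>\<^sup>2) ^ R * ennreal (\<theta>\<^sup>2) ^ R) = 1"
      proof -
        have pow: "(\<theta>\<^sup>2) ^ R = exp (real R * (2 * - a))"
          by (simp add: \<theta>_def flip: exp_double exp_of_nat_mult)
        have "exp \<epsilon> * ((\<theta>\<^sup>2) ^ R * (\<theta>\<^sup>2) ^ R) = exp (\<epsilon> + (real R * (2 * - a) + real R * (2 * - a)))"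
          by (simp only: pow exp_add)
        also have "\<epsilon> + (real R * (2 * - a) + real R * (2 * - a)) = 0"
          using Ra by (simp add: algebra_simps)
        finally show ?thesis
          using \<theta> by (simp add: ennreal_power flip: ennreal_mult)
      qed
      ultimately show "F (\<lambda>q. w q - (v d q - v d' q)) \<le> ennreal (exp \<epsilon>) * F w"
        by (simp add: mult.assoc[symmetric])
    qed
  next
    \<comment> \<open>All entries are at most 1 in absolute value and \<open>u e\<close> carries the
      factor \<open>1 / R\<close>, so one step changes each pairing by at most \<open>k / R\<close>.
      The \<open>max 0\<close> below accounts for the truncation of negative pairings.\<close>
    have lip: "H (\<lambda>q. w q + real c * u e q) \<le> H w + ennreal (real c) * ennreal (k / R)" if e: "e \<in> E" for e c w
      unfolding H_def
    proof (rule SUP_least)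
      fix f assume f: "f \<in> E"
      have "(\<Sum>q\<in>Q. u e q * (snd f * v (fst f) q)) \<le> (\<Sum>q\<in>Q. 1 / R)"
      proof (rule sum_mono)
        fix q
        have "(snd e * v (fst e) q) * (snd f * v (fst f) q) \<le> \<bar>snd e * v (fst e) q\<bar> * \<bar>snd f * v (fst f) q\<bar>"
          by (simp flip: abs_mult)
        also have "\<dots> \<le> 1 * 1" by (intro mult_mono v1 e f) auto
        finally show "u e q * (snd f * v (fst f) q) \<le> 1 / R"
          using R by (simp add: u_def divide_right_mono)
      qed
      then have "real c * (\<Sum>q\<in>Q. u e q * (snd f * v (fst f) q)) \<le> real c * (k / R)"
        by (intro mult_left_mono) (auto simp: k_def)
      then have "ennreal (\<Sum>q\<in>Q. (w q + real c * u e q) * (snd f * v (fst f) q))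
          \<le> ennreal (max 0 (\<Sum>q\<in>Q. w q * (snd f * v (fst f) q)) + real c * (k / R))"
        by (intro ennreal_leI) (simp add: distrib_right sum.distrib sum_distrib_left mult.assoc)
      also have "\<dots> = ennreal (\<Sum>q\<in>Q. w q * (snd f * v (fst f) q)) + ennreal (real c) * ennreal (k / R)"
        using k ennreal_mult[of "real c" "k / R"] by (simp add: max_def ennreal_neg)
      also have "\<dots> \<le> (SUP f\<in>E. ennreal (\<Sum>q\<in>Q. w q * (snd f * v (fst f) q))) + ennreal (real c) * ennreal (k / R)"
        by (intro add_right_mono SUP_upper f)
      finally show "ennreal (\<Sum>q\<in>Q. (w q + real c * u e q) * (snd f * v (fst f) q)) \<le> \<dots>" .
    qed
    have "(\<integral>\<^sup>+w. F w * H w \<partial>lborel_prod Q)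
        \<le> 2 * (\<integral>\<^sup>+w. g w * H w \<partial>lborel_prod Q) + ennreal (\<theta> / (1 - \<theta>)) * ennreal (k / R)"
      unfolding F_def by (rule nn_integral_jump_density_mult_le[OF \<theta> Q(1) E g u0 mass H lip])
    also have "2 * (\<integral>\<^sup>+w. g w * H w \<partial>lborel_prod Q) = (\<integral>\<^sup>+w. ennreal (gaussian_density Q V w) * H w \<partial>lborel_prod Q)"
    proof -
      have "2 * ennreal (1 / 2) = 1"
        using ennreal_mult[of 2 "1 / 2"] by simp
      then have *: "2 * (g w * H w) = ennreal (gaussian_density Q V w) * H w" for w
        by (simp only: half mult.assoc[symmetric] mult_1)
      have "(\<lambda>w. g w * H w) \<in> borel_measurable (lborel_prod Q)" by measurable
      from nn_integral_cmult[OF this, of 2] show ?thesis by (simp only: *)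
    qed
    also have "\<dots> \<le> ennreal ((2 * ln (card E) + 1) / (\<epsilon> / (10 * k)))"
      unfolding H_def
    proof (rule nn_integral_gaussian_SUP_le[OF Q(1) V E])
      \<comment> \<open>This exponent meets the variance condition: with
        \<open>V = 32 * (N * a) * k / \<epsilon>^2\<close> the left side is at most
        \<open>0.16 * N * a\<close>, and \<open>N * a \<le> 6 * l\<close>.\<close>
      show "0 < \<epsilon> / (10 * k)" using \<epsilon> k by simp
      show "snd e * v (fst e) q = 0" if "q \<notin> Q" for e q using v0 that by simp
      show "(\<epsilon> / (10 * k))\<^sup>2 * V * (\<Sum>q\<in>Q. (snd e * v (fst e) q)\<^sup>2) / 2 \<le> ln (card E)" if "e \<in> E" for e
      proof -
        have "(\<epsilon> / (10 * k))\<^sup>2 * V * (\<Sum>q\<in>Q. (snd e * v (fst e) q)\<^sup>2) / 2 \<le> (\<epsilon> / (10 * k))\<^sup>2 * V * k / 2"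
          using v2[OF that] V by (intro divide_right_mono mult_left_mono) auto
        also have "\<dots> = 32 / 200 * (N * a)"
          using \<epsilon> k by (simp add: Vk field_simps power2_eq_square)
        also have "\<dots> \<le> l" using N l by linarith
        finally show ?thesis by (simp add: l_def cE)
      qed
    qed
    \<comment> \<open>Both constants come from \<open>l \<ge> 2 / 3\<close>: it gives
      \<open>10 * (2 * l + 1) \<le> 35 * l\<close> for the Gaussian, and for the jumps \<open>k / (R
      * a) = 4 * k / \<epsilon> \<le> 6 * l * k / \<epsilon>\<close>.\<close>
    also have "ennreal ((2 * ln (card E) + 1) / (\<epsilon> / (10 * k))) + ennreal (\<theta> / (1 - \<theta>)) * ennreal (k / R)
        \<le> ennreal (35 * l * k / \<epsilon>) + ennreal (6 * l * k / \<epsilon>)"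
    proof (rule add_mono)
      have "(2 * l + 1) * (10 * k) \<le> (35 / 10 * l) * (10 * k)"
        using l k by (intro mult_right_mono) auto
      then have "(2 * l + 1) / (\<epsilon> / (10 * k)) \<le> 35 * l * k / \<epsilon>"
        using \<epsilon> by (simp add: divide_right_mono)
      then show "ennreal ((2 * ln (card E) + 1) / (\<epsilon> / (10 * k))) \<le> ennreal (35 * l * k / \<epsilon>)"
        by (intro ennreal_leI) (simp add: cE l_def)
      have "\<theta> * (1 + a) \<le> \<theta> * exp a"
        using \<theta> by (intro mult_left_mono) auto
      also have "\<theta> * exp a = 1" by (simp add: \<theta>_def exp_minus)
      finally have "\<theta> / (1 - \<theta>) \<le> 1 / a"
        using \<theta> a by (simp add: field_simps)
      then have "\<theta> / (1 - \<theta>) * (k / R) \<le> 1 / a * (k / R)"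
        using k by (intro mult_right_mono) auto
      also have "\<dots> = k * 4 / \<epsilon>" using R \<epsilon> by (simp add: a_def)
      also have "\<dots> \<le> k * (6 * l) / \<epsilon>"
        using k l \<epsilon> by (intro divide_right_mono mult_left_mono) auto
      finally show "ennreal (\<theta> / (1 - \<theta>)) * ennreal (k / R) \<le> ennreal (6 * l * k / \<epsilon>)"
        using \<theta> k by (simp add: mult_ac ennreal_leI flip: ennreal_mult)
    qed
    also have "\<dots> = ennreal (41 * l * k / \<epsilon>)"
      using l k \<epsilon> by (subst ennreal_plus[symmetric]) (auto simp: field_simps)
    finally show "(\<integral>\<^sup>+w. F w * (SUP e\<in>D \<times> {- 1, 1}. ennreal (\<Sum>q\<in>Q. w q * (snd e * v (fst e) q))) \<partial>lborel_prod Q)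
        \<le> ennreal (41 * ln (2 * real (card D)) * card Q / \<epsilon>)"
      by (simp add: H_def E_def l_def k_def)
  qed
qed

section \<open>The least squares mechanism\<close>

lemma pmf_of_finite_weights:
  fixes p :: "'x \<Rightarrow> ennreal"
  assumes X: "finite X" and p: "(\<Sum>x\<in>X. p x) = 1"
  obtains P where "set_pmf P \<subseteq> X" and "\<And>x. x \<in> X \<Longrightarrow> ennreal (pmf P x) = p x"
proof -
  define f where "f x = (if x \<in> X then enn2real (p x) else 0)" for x
  have fin: "ennreal (enn2real (p x)) = p x" if "x \<in> X" for x
  proof (rule ennreal_enn2real)
    have "p x \<le> 1" using member_le_sum[OF that, of p] X p by simp
    then show "p x < top" using ennreal_one_less_top by (rule le_less_trans)
  qed
  have f0: "0 \<le> f x" for x by (simp add: f_def)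
  have "(\<integral>\<^sup>+x. f x \<partial>count_space UNIV) = (\<Sum>x\<in>X. ennreal (f x))"
    using X by (intro nn_integral_count_space') (auto simp: f_def)
  also have "\<dots> = 1" using p by (simp add: f_def fin)
  finally have f1: "(\<integral>\<^sup>+x. f x \<partial>count_space UNIV) = 1" .
  note pmf_f = pmf_embed_pmf[of f, OF f0 f1]
  show thesis
  proof (rule that[of "embed_pmf f"])
    show "set_pmf (embed_pmf f) \<subseteq> X"
      unfolding set_pmf_eq pmf_f by (auto simp: f_def split: if_splits)
    show "ennreal (pmf (embed_pmf f) x) = p x" if "x \<in> X" for x
      unfolding pmf_f using that by (simp add: f_def fin)
  qed
qed

text \<open>The output is a post-processing of \<open>z = s x + w\<close>, so a pointwise bound on
  the shifted densities integrates to one on the output probabilities. For the error, an output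
  \<open>y\<close> is at least as near to \<open>z\<close> as \<open>x\<close> is, and expanding
  \<open>|z - s y|^2 \<le> |z - s x|^2\<close> gives the condition linking \<open>G\<close> and
  \<open>H\<close>.\<close>

lemma least_squares_mechanism:
  fixes s :: "'x \<Rightarrow> 'q \<Rightarrow> real" and F :: "('q \<Rightarrow> real) \<Rightarrow> ennreal"
  assumes X: "finite X" "X \<noteq> {}" and Q: "finite Q" and s0: "\<And>x q. q \<notin> Q \<Longrightarrow> s x q = 0"
    and F[measurable]: "F \<in> borel_measurable (lborel_prod Q)"
    and F1: "(\<integral>\<^sup>+w. F w \<partial>lborel_prod Q) = 1"
  obtains P :: "'x \<Rightarrow> 'x pmf" where
    "\<And>x. set_pmf (P x) \<subseteq> X"
    "\<And>x x' b y. (\<And>w. F (\<lambda>q. w q - s x q) \<le> b * F (\<lambda>q. w q - s x' q)) \<Longrightarrow> y \<in> X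
      \<Longrightarrow> ennreal (pmf (P x) y) \<le> b * ennreal (pmf (P x') y)"
    "\<And>x G H. x \<in> X \<Longrightarrow> H \<in> borel_measurable (lborel_prod Q)
      \<Longrightarrow> (\<And>y w. y \<in> X \<Longrightarrow> (\<Sum>q\<in>Q. (s y q - s x q)\<^sup>2) \<le> 2 * (\<Sum>q\<in>Q. w q * (s y q - s x q)) \<Longrightarrow> G y \<le> H w)
      \<Longrightarrow> (\<Sum>y\<in>X. ennreal (pmf (P x) y) * G y) \<le> (\<integral>\<^sup>+w. F w * H w \<partial>lborel_prod Q)"
proof -
  define dst where "dst z y = (\<Sum>q\<in>Q. (z q - s y q)\<^sup>2)" for z y
  \<comment> \<open>Ties are shared equally among all nearest points, which makes the kernel
    \<open>K\<close> visibly measurable in \<open>z\<close>.\<close>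
  define I where "I z y = (if \<forall>y'\<in>X. dst z y \<le> dst z y' then 1 else 0 :: real)" for z y
  define K where "K z y = ennreal (I z y / (\<Sum>y\<in>X. I z y))" for z y
  define p where "p x y = (\<integral>\<^sup>+z. K z y * F (\<lambda>q. z q - s x q) \<partial>lborel_prod Q)" for x y
  have dst: "(\<lambda>z. dst z y) \<in> borel_measurable (lborel_prod Q)" for y
    unfolding dst_def by measurable
  have [measurable]: "(\<lambda>z. I z y) \<in> borel_measurable (lborel_prod Q)" for y
  proof -
    have "Measurable.pred (lborel_prod Q) (\<lambda>z. \<forall>y'\<in>X. dst z y \<le> dst z y')"
      using X(1)
    proof (rule pred_intros_finite)
      show "Measurable.pred (lborel_prod Q) (\<lambda>z. dst z y \<le> dst z y')" for y'
        unfolding pred_def by (intro borel_measurable_le dst)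
    qed
    then show ?thesis unfolding I_def by measurable
  qed
  have [measurable]: "(\<lambda>z. K z y) \<in> borel_measurable (lborel_prod Q)" for y
    unfolding K_def by measurable
  have Fs[measurable]: "(\<lambda>z. F (\<lambda>q. z q - s x q)) \<in> borel_measurable (lborel_prod Q)" for x
    by (intro measurable_compose_translate F s0)
  have K1: "(\<Sum>y\<in>X. K z y) = 1" for z
  proof -
    have "is_arg_min (dst z) (\<lambda>y. y \<in> X) (arg_min_on (dst z) X)"
      using arg_min_if_finite[OF X, of "dst z"] by (auto simp: is_arg_min_def)
    then have y: "arg_min_on (dst z) X \<in> X" "I z (arg_min_on (dst z) X) = 1"
      by (auto simp: is_arg_min_def I_def not_less)
    have I0: "0 \<le> I z y" for y by (simp add: I_def)
    have "1 \<le> (\<Sum>y\<in>X. I z y)"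
      using member_le_sum[of "arg_min_on (dst z) X" X "I z"] y I0 X by simp
    then show ?thesis
      unfolding K_def using I0 by (subst sum_ennreal) (auto simp flip: sum_divide_distrib)
  qed
  have p1: "(\<Sum>y\<in>X. p x y) = 1" for x
  proof -
    have "(\<Sum>y\<in>X. p x y) = (\<integral>\<^sup>+z. (\<Sum>y\<in>X. K z y) * F (\<lambda>q. z q - s x q) \<partial>lborel_prod Q)"
      unfolding p_def by (subst nn_integral_sum[symmetric]) (auto simp: sum_distrib_right)
    also have "\<dots> = 1"
      using nn_integral_translate[OF Q F s0[of _ x]] F1 by (simp add: K1)
    finally show ?thesis .
  qed
  have "\<forall>x. \<exists>P. set_pmf P \<subseteq> X \<and> (\<forall>y\<in>X. ennreal (pmf P y) = p x y)"
    using pmf_of_finite_weights[OF X(1) p1] by metis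
  then obtain P where P: "\<And>x. set_pmf (P x) \<subseteq> X" "\<And>x y. y \<in> X \<Longrightarrow> ennreal (pmf (P x) y) = p x y"
    by metis
  show thesis
  proof (rule that[of P])
    show "set_pmf (P x) \<subseteq> X" for x by (rule P)
  next
    fix x x' b y
    assume le: "\<And>w. F (\<lambda>q. w q - s x q) \<le> b * F (\<lambda>q. w q - s x' q)" and y: "y \<in> X"
    have "p x y \<le> (\<integral>\<^sup>+z. b * (K z y * F (\<lambda>q. z q - s x' q)) \<partial>lborel_prod Q)"
      unfolding p_def
    proof (rule nn_integral_mono)
      fix z
      show "K z y * F (\<lambda>q. z q - s x q) \<le> b * (K z y * F (\<lambda>q. z q - s x' q))"
        using mult_left_mono[OF le[of z], of "K z y"] by (simp add: mult_ac)
    qed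
    also have "\<dots> = b * p x' y"
      unfolding p_def by (intro nn_integral_cmult) measurable
    finally show "ennreal (pmf (P x) y) \<le> b * ennreal (pmf (P x') y)"
      using P(2)[OF y] by simp
  next
    fix x and G :: "'x \<Rightarrow> ennreal" and H :: "('q \<Rightarrow> real) \<Rightarrow> ennreal"
    assume x: "x \<in> X" and H[measurable]: "H \<in> borel_measurable (lborel_prod Q)"
      and GH: "\<And>y w. y \<in> X \<Longrightarrow> (\<Sum>q\<in>Q. (s y q - s x q)\<^sup>2) \<le> 2 * (\<Sum>q\<in>Q. w q * (s y q - s x q)) \<Longrightarrow> G y \<le> H w"
    have Hs[measurable]: "(\<lambda>z. H (\<lambda>q. z q - s x q)) \<in> borel_measurable (lborel_prod Q)"
      by (intro measurable_compose_translate H s0)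
    have KG: "K z y * G y \<le> K z y * H (\<lambda>q. z q - s x q)" if y: "y \<in> X" for z y
    proof (cases "I z y = 0")
      case False
      then have "dst z y \<le> dst z x" using x by (auto simp: I_def split: if_splits)
      moreover have "dst z y - dst z x
          = (\<Sum>q\<in>Q. (s y q - s x q)\<^sup>2) - 2 * (\<Sum>q\<in>Q. (z q - s x q) * (s y q - s x q))"
        unfolding dst_def sum_distrib_left sum_subtractf[symmetric]
        by (intro sum.cong) (auto simp: algebra_simps power2_eq_square)
      ultimately have "G y \<le> H (\<lambda>q. z q - s x q)"
        by (intro GH y) linarith
      then show ?thesis by (intro mult_left_mono) auto
    qed (simp add: K_def)
    have "(\<Sum>y\<in>X. ennreal (pmf (P x) y) * G y)
        = (\<Sum>y\<in>X. \<integral>\<^sup>+z. (K z y * F (\<lambda>q. z q - s x q)) * G y \<partial>lborel_prod Q)"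
      by (intro sum.cong refl) (simp add: P(2) p_def nn_integral_multc)
    also have "\<dots> = (\<integral>\<^sup>+z. (\<Sum>y\<in>X. (K z y * F (\<lambda>q. z q - s x q)) * G y) \<partial>lborel_prod Q)"
      by (intro nn_integral_sum[symmetric]) measurable
    also have "\<dots> \<le> (\<integral>\<^sup>+z. F (\<lambda>q. z q - s x q) * H (\<lambda>q. z q - s x q) \<partial>lborel_prod Q)"
    proof (rule nn_integral_mono)
      fix z
      have "(\<Sum>y\<in>X. (K z y * F (\<lambda>q. z q - s x q)) * G y)
          = F (\<lambda>q. z q - s x q) * (\<Sum>y\<in>X. K z y * G y)"
        by (simp add: sum_distrib_left mult_ac)
      also have "\<dots> \<le> F (\<lambda>q. z q - s x q) * (\<Sum>y\<in>X. K z y * H (\<lambda>q. z q - s x q))"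
        by (intro mult_left_mono sum_mono KG) auto
      also have "(\<Sum>y\<in>X. K z y * H (\<lambda>q. z q - s x q)) = H (\<lambda>q. z q - s x q)"
        by (simp add: K1 flip: sum_distrib_right)
      finally show "(\<Sum>y\<in>X. (K z y * F (\<lambda>q. z q - s x q)) * G y)
          \<le> F (\<lambda>q. z q - s x q) * H (\<lambda>q. z q - s x q)" .
    qed
    also have "\<dots> = (\<integral>\<^sup>+w. F w * H w \<partial>lborel_prod Q)"
      by (rule nn_integral_translate[OF Q _ s0[of _ x], of "\<lambda>w. F w * H w"]) measurable
    finally show "(\<Sum>y\<in>X. ennreal (pmf (P x) y) * G y) \<le> (\<integral>\<^sup>+w. F w * H w \<partial>lborel_prod Q)" .
  qed
qed

section \<open>Privacy and mean error of the mechanism\<close>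

theorem theorem1p2:
  fixes D :: "'d set" and Q :: "'q set" and query :: "'q \<Rightarrow> 'd \<Rightarrow> real"
    and n :: nat and \<epsilon> :: real
  assumes "finite D" and "card D \<ge> 1"
    and "finite Q" and "card Q \<ge> 1"
    and "n \<ge> 1"
    and "\<And>q d. q \<in> Q \<Longrightarrow> d \<in> D \<Longrightarrow> query q d \<in> {-1..1}"
    and "\<epsilon> > 0"
  shows "\<exists>M\<^sub>2 :: (nat \<Rightarrow> 'd) \<Rightarrow> ('q \<Rightarrow> real) pmf.
    randomized_mechanism n D (real_vectors Q) M\<^sub>2 \<and>
    pure_differentially_private n D (real_vectors Q) \<epsilon> M\<^sub>2 \<and>
    (SUP x \<in> databases n D. (1 / sqrt (real (card Q))) *
        measure_pmf.expectation (M\<^sub>2 x) (\<lambda>z. L2_set (\<lambda>q. z q - answers n Q query x q) Q))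
      \<le> 62 * exp 1 * min 1 (sqrt (ln (2 * real (card D)) / (\<epsilon> * real n)))"
proof -
  define X where "X = databases n D"
  define v where "v d q = (if q \<in> Q then query q d else 0)" for d q
  define s where "s x q = (\<Sum>i=1..n. v (x i) q)" for x :: "nat \<Rightarrow> 'd" and q
  define H where "H w = (SUP e\<in>D \<times> {- 1, 1}. ennreal (\<Sum>q\<in>Q. w q * (snd e * v (fst e) q)))"
    for w :: "'q \<Rightarrow> real"
  define k where "k = real (card Q)"
  define l where "l = ln (2 * real (card D))"
  define r where "r = sqrt (l / (\<epsilon> * n))"
  have D: "finite D" "D \<noteq> {}" using assms(1,2) by auto
  have Q: "finite Q" "Q \<noteq> {}" using assms(3,4) by auto
  have n: "n \<ge> 1" and \<epsilon>: "\<epsilon> > 0" by fact+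
  have k: "k \<ge> 1" using assms(4) by (simp add: k_def)
  have l: "l > 0" using assms(2) by (simp add: l_def)
  have r: "r > 0" "r\<^sup>2 = l / (\<epsilon> * n)" using l n \<epsilon> by (auto simp: r_def)
  have X: "finite X" "X \<noteq> {}"
    using D by (auto simp: X_def databases_def finite_PiE PiE_eq_empty_iff)
  have v0: "v d q = 0" if "q \<notin> Q" for d q using that by (simp add: v_def)
  have s0: "s x q = 0" if "q \<notin> Q" for x q using v0[OF that] by (simp add: s_def)
  have v1: "\<bar>v d q\<bar> \<le> 1" if "d \<in> D" for d q
    using assms(6)[of q d] that by (auto simp: v_def abs_le_iff)
  have ans: "answers n Q query x q = s x q / n" if "q \<in> Q" for x q
    using that by (simp add: answers_def s_def v_def)
  obtain F where F: "F \<in> borel_measurable (lborel_prod Q)" "(\<integral>\<^sup>+w. F w \<partial>lborel_prod Q) = 1"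
    and priv: "\<forall>d\<in>D. \<forall>d'\<in>D. \<forall>w. F (\<lambda>q. w q - (v d q - v d' q)) \<le> ennreal (exp \<epsilon>) * F w"
    and FH: "(\<integral>\<^sup>+w. F w * H w \<partial>lborel_prod Q) \<le> ennreal (41 * l * k / \<epsilon>)"
    unfolding H_def l_def k_def
    by (rule private_noise_density[OF D Q \<epsilon>, of v, OF v1 v0])
  have Hm[measurable]: "H \<in> borel_measurable (lborel_prod Q)"
    unfolding H_def using D by (intro borel_measurable_SUP countable_finite) auto
  obtain P :: "(nat \<Rightarrow> 'd) \<Rightarrow> (nat \<Rightarrow> 'd) pmf" where PX: "\<And>x. set_pmf (P x) \<subseteq> X"
    and P_le: "\<And>x x' b y. (\<And>w. F (\<lambda>q. w q - s x q) \<le> b * F (\<lambda>q. w q - s x' q)) \<Longrightarrow> y \<in> X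
      \<Longrightarrow> ennreal (pmf (P x) y) \<le> b * ennreal (pmf (P x') y)"
    and P_err: "\<And>x G H. x \<in> X \<Longrightarrow> H \<in> borel_measurable (lborel_prod Q)
      \<Longrightarrow> (\<And>y w. y \<in> X \<Longrightarrow> (\<Sum>q\<in>Q. (s y q - s x q)\<^sup>2) \<le> 2 * (\<Sum>q\<in>Q. w q * (s y q - s x q)) \<Longrightarrow> G y \<le> H w)
      \<Longrightarrow> (\<Sum>y\<in>X. ennreal (pmf (P x) y) * G y) \<le> (\<integral>\<^sup>+w. F w * H w \<partial>lborel_prod Q)"
    using least_squares_mechanism[OF X Q(1), of s, OF s0 F] by blast
  define M where "M x = map_pmf (answers n Q query) (P x)" for x
  have "finite (set_pmf (M x)) \<and> set_pmf (M x) \<subseteq> real_vectors Q" for x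
    using finite_subset[OF PX X(1)] by (auto simp: M_def real_vectors_def answers_def)
  moreover have "measure_pmf.prob (M x) A \<le> exp \<epsilon> * measure_pmf.prob (M x') A"
    if x: "x \<in> X" "x' \<in> X" and nb: "neighboring n x x'" for x x' A
  proof -
    obtain j where j: "{i \<in> {1..n}. x i \<noteq> x' i} = {j}"
      using nb by (auto simp: neighboring_def card_1_singleton_iff)
    then have j': "j \<in> {1..n}" "x j \<noteq> x' j" and eq: "\<And>i. i \<in> {1..n} - {j} \<Longrightarrow> x i = x' i" by auto
    \<comment> \<open>Neighbors move the query sums by a difference of two vectors
      \<open>v d\<close>, exactly the shift for which the noise is private.\<close>
    have "s x q - s x' q = v (x j) q - v (x' j) q" for q
    proof -
      have "s x q - s x' q = (\<Sum>i=1..n. v (x i) q - v (x' i) q)"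
        by (simp add: s_def sum_subtractf)
      also have "\<dots> = (\<Sum>i\<in>{j}. v (x i) q - v (x' i) q)"
        using j'(1) eq by (intro sum.mono_neutral_right) auto
      finally show ?thesis by simp
    qed
    then have sx: "w q - s x q = (w q - s x' q) - (v (x j) q - v (x' j) q)" for w :: "'q \<Rightarrow> real" and q
      by (simp add: algebra_simps)
    have "x j \<in> D" "x' j \<in> D" using x j' by (auto simp: X_def databases_def)
    then have "F (\<lambda>q. w q - s x q) \<le> ennreal (exp \<epsilon>) * F (\<lambda>q. w q - s x' q)" for w
      unfolding sx using priv[rule_format, of "x j" "x' j" "\<lambda>q. w q - s x' q"] by blast
    then have pm: "pmf (P x) y \<le> exp \<epsilon> * pmf (P x') y" if "y \<in> X" for y
      using P_le[of x "ennreal (exp \<epsilon>)" x' y] that by (simp flip: ennreal_mult)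
    have prob: "measure_pmf.prob (M x) A = (\<Sum>y\<in>answers n Q query -` A \<inter> X. pmf (P x) y)" for x
    proof -
      have "measure_pmf.prob (M x) A = measure_pmf.prob (P x) (answers n Q query -` A \<inter> set_pmf (P x))"
        by (simp add: M_def measure_Int_set_pmf)
      also have "answers n Q query -` A \<inter> set_pmf (P x) = (answers n Q query -` A \<inter> X) \<inter> set_pmf (P x)"
        using PX by auto
      also have "measure_pmf.prob (P x) \<dots> = (\<Sum>y\<in>answers n Q query -` A \<inter> X. pmf (P x) y)"
        using X by (simp add: measure_Int_set_pmf measure_measure_pmf_finite)
      finally show ?thesis .
    qed
    show ?thesis
      unfolding prob sum_distrib_left by (intro sum_mono pm) auto
  qed
  moreover have "(1 / sqrt k) * measure_pmf.expectation (M x) (\<lambda>z. L2_set (\<lambda>q. z q - answers n Q query x q) Q)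
      \<le> 62 * exp 1 * min 1 r" if x: "x \<in> X" for x
  proof -
    define err where "err y = L2_set (\<lambda>q. answers n Q query y q - answers n Q query x q) Q / sqrt k" for y
    have err2: "(err y)\<^sup>2 = (\<Sum>q\<in>Q. (s y q - s x q)\<^sup>2) / ((real n)\<^sup>2 * k)" for y
    proof -
      have "(\<Sum>q\<in>Q. (answers n Q query y q - answers n Q query x q)\<^sup>2) = (\<Sum>q\<in>Q. (s y q - s x q)\<^sup>2 / (real n)\<^sup>2)"
        by (intro sum.cong refl) (simp add: ans power_divide flip: diff_divide_distrib)
      then show ?thesis
        using k by (simp add: err_def L2_set_def power_divide sum_nonneg flip: sum_divide_distrib)
    qed
    have expct: "(1 / sqrt k) * measure_pmf.expectation (M x) (\<lambda>z. L2_set (\<lambda>q. z q - answers n Q query x q) Q)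
        = (\<Sum>y\<in>X. pmf (P x) y * err y)"
      using X(1) PX[of x]
      by (simp add: M_def integral_measure_pmf_real[of X] err_def sum_divide_distrib mult_ac set_mp)
    have one: "(\<Sum>y\<in>X. pmf (P x) y) = 1"
      using sum_pmf_eq_1[OF X(1) PX] .
    \<comment> \<open>The trivial bound, for the branch 1 of the minimum: every query sum lies
      between \<open>- n\<close> and \<open>n\<close>.\<close>
    have le2: "err y \<le> 2" if y: "y \<in> X" for y
    proof (rule power2_le_imp_le)
      have "(\<Sum>q\<in>Q. (s y q - s x q)\<^sup>2) \<le> (\<Sum>q\<in>Q. (2 * real n)\<^sup>2)"
      proof (rule sum_mono)
        fix q
        have "\<bar>s z q\<bar> \<le> real n" if "z \<in> X" for z
        proof -
          have "\<bar>s z q\<bar> \<le> (\<Sum>i=1..n. \<bar>v (z i) q\<bar>)" unfolding s_def by (rule sum_abs)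
          also have "\<dots> \<le> (\<Sum>i=1..n. 1)"
            using that by (intro sum_mono v1) (auto simp: X_def databases_def)
          finally show ?thesis by simp
        qed
        from this[OF x] this[OF y] have "\<bar>s y q - s x q\<bar> \<le> 2 * real n" by linarith
        then show "(s y q - s x q)\<^sup>2 \<le> (2 * real n)\<^sup>2"
          using abs_le_square_iff[of "s y q - s x q" "2 * real n"] by simp
      qed
      then show "(err y)\<^sup>2 \<le> 2\<^sup>2"
        using k n by (simp add: err2 k_def[symmetric] pos_divide_le_eq power_mult_distrib mult_ac)
    qed simp
    \<comment> \<open>The factor \<open>n * k / 4\<close> turns \<open>(err y)^2\<close> into
      \<open>|s y - s x|^2 / (4 * n)\<close>, which the least squares condition bounds by
      \<open>H w\<close>.\<close>
    have "(\<Sum>y\<in>X. ennreal (pmf (P x) y) * ennreal ((err y)\<^sup>2 * (n * k / 4))) \<le> (\<integral>\<^sup>+w. F w * H w \<partial>lborel_prod Q)"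
    proof (rule P_err[OF x Hm])
      fix y w assume y: "y \<in> X" and ls: "(\<Sum>q\<in>Q. (s y q - s x q)\<^sup>2) \<le> 2 * (\<Sum>q\<in>Q. w q * (s y q - s x q))"
      show "ennreal ((err y)\<^sup>2 * (n * k / 4)) \<le> H w"
      proof (cases "H w = top")
        case False
        define h where "h = enn2real (H w)"
        have Hw: "H w = ennreal h" using False by (simp add: h_def less_top)
        have h: "(\<Sum>q\<in>Q. w q * (c * v d q)) \<le> h" if "d \<in> D" "c \<in> {- 1, 1}" for d c
        proof -
          have "ennreal (\<Sum>q\<in>Q. w q * (c * v d q)) \<le> H w"
            unfolding H_def using that by (intro SUP_upper2[of "(d, c)"]) auto
          also note Hw
          finally show ?thesis by (simp add: h_def ennreal_le_iff)
        qed
        \<comment> \<open>The difference of the query sums consists of \<open>2 * n\<close> signed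
          vectors, and each pairs with \<open>w\<close> to at most \<open>h\<close>.\<close>
        have "(\<Sum>q\<in>Q. w q * (s y q - s x q))
            = (\<Sum>i=1..n. (\<Sum>q\<in>Q. w q * (1 * v (y i) q)) + (\<Sum>q\<in>Q. w q * (- 1 * v (x i) q)))"
          unfolding s_def sum_subtractf[symmetric] sum_distrib_left
          by (subst sum.swap) (simp add: sum.distrib[symmetric] algebra_simps)
        also have "\<dots> \<le> (\<Sum>i=1..n. h + h)"
          using x y by (intro sum_mono add_mono h) (auto simp: X_def databases_def)
        finally have "(\<Sum>q\<in>Q. (s y q - s x q)\<^sup>2) \<le> 4 * n * h" using ls by simp
        then have "(\<Sum>q\<in>Q. (s y q - s x q)\<^sup>2) / (4 * n) \<le> h"
          using n by (simp add: pos_divide_le_eq mult_ac)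
        then have "(err y)\<^sup>2 * (n * k / 4) \<le> h"
          using k n by (simp add: err2 power2_eq_square[of "real n"] mult_ac)
        then show ?thesis unfolding Hw by (rule ennreal_leI)
      qed simp
    qed
    also have "\<dots> \<le> ennreal (41 * l * k / \<epsilon>)" by (rule FH)
    finally have "(\<Sum>y\<in>X. pmf (P x) y * ((err y)\<^sup>2 * (n * k / 4))) \<le> 41 * l * k / \<epsilon>"
      using k l \<epsilon> by (simp flip: ennreal_mult add: sum_nonneg)
    then have "(\<Sum>y\<in>X. pmf (P x) y * (err y)\<^sup>2) * (n * k / 4) \<le> 41 * l * k / \<epsilon>"
      by (simp only: sum_distrib_right mult.assoc)
    then have mse: "(\<Sum>y\<in>X. pmf (P x) y * (err y)\<^sup>2) \<le> 164 * r\<^sup>2"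
      using k n \<epsilon> by (simp add: r(2) field_simps)
    \<comment> \<open>From the second moment to the mean by the arithmetic-geometric inequality. The
      weight \<open>r\<close> matches a second moment of order \<open>r^2\<close> and gives
      \<open>82 * r + r / 2\<close>.\<close>
    have "(\<Sum>y\<in>X. pmf (P x) y * err y) \<le> (\<Sum>y\<in>X. pmf (P x) y * ((err y)\<^sup>2 / (2 * r) + r / 2))"
    proof (intro sum_mono mult_left_mono)
      fix y
      have "0 \<le> (err y - r)\<^sup>2" by simp
      then show "err y \<le> (err y)\<^sup>2 / (2 * r) + r / 2"
        using r(1) by (simp add: power2_diff field_simps power2_eq_square)
    qed simp
    also have "\<dots> = (\<Sum>y\<in>X. pmf (P x) y * (err y)\<^sup>2) / (2 * r) + (\<Sum>y\<in>X. pmf (P x) y) * (r / 2)"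
      by (simp add: distrib_left sum.distrib sum_divide_distrib sum_distrib_right)
    also have "\<dots> \<le> 164 * r\<^sup>2 / (2 * r) + r / 2"
      unfolding one using mse r(1) by (intro add_mono divide_right_mono) auto
    also have "\<dots> = 82 * r + r / 2" using r(1) by (simp add: power2_eq_square)
    finally have bound: "(\<Sum>y\<in>X. pmf (P x) y * err y) \<le> 83 * r" using r(1) by simp
    have "(\<Sum>y\<in>X. pmf (P x) y * err y) \<le> (\<Sum>y\<in>X. pmf (P x) y * 2)"
      by (intro sum_mono mult_left_mono le2) auto
    then have bound2: "(\<Sum>y\<in>X. pmf (P x) y * err y) \<le> 2" by (simp add: one flip: sum_distrib_right)
    \<comment> \<open>Hence \<open>62 * exp 1\<close> is at least 124, above the constants 83 and 2
      of the two branches.\<close>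
    have e: "2 \<le> exp (1 :: real)" using exp_ge_add_one_self[of 1] by simp
    have "83 * min 1 r \<le> 62 * exp 1 * min 1 r"
      using e r(1) by (intro mult_right_mono) auto
    then show ?thesis
      unfolding expct using bound bound2 e by (auto simp: min_def split: if_splits)
  qed
  then have "(SUP x \<in> X. (1 / sqrt k) * measure_pmf.expectation (M x) (\<lambda>z. L2_set (\<lambda>q. z q - answers n Q query x q) Q))
      \<le> 62 * exp 1 * min 1 r"
    using X(2) by (intro cSUP_least) auto
  ultimately show ?thesis
    unfolding randomized_mechanism_def pure_differentially_private_def X_def k_def r_def l_def by blast
qed

end
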